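(* Let $(W,S)$ be a Coxeter system of finite rank with $m_{rt}<\infty$ for all $r,t\in S$. Let $V=\bigoplus_{s\in S}\mathbb{C}\alpha_s$ be an IR-representation defined by the datum $(k_{rt},a_r^t)_{r\ne t\in S}$, with corresponding data $((k_{rt})_{r,t},\chi)$. Let $\{\alpha_s^*\}_{s\in S}$ be the dual basis in $V^*=\operatorname{Hom}_{\mathbb{C}}(V,\mathbb{C})$, regarded as a representation of $W$ via $(s\cdot\alpha_t^* )(-)=\alpha_t^*(s\cdot-)$ for $s\in S$, and for $s\in S$ put $$\gamma_s:=\alpha_s^*-\sum_{t\neq s}\frac{a_s^t}{a_t^s}\cos\frac{k_{st}\pi}{m_{st}}\,\alpha_t^*,$$ which is, up to scalar, the unique $-1$-eigenvector of $s$ in $V^*$. Let $A=(A_{st})_{s,t\in S}$ be the matrix with $A_{ss}=1$ and $A_{st}=-\frac{a_s^t}{a_t^s}\cos\frac{k_{st}\pi}{m_{st}}$ for $s\ne t$. Then: (1) $\{\gamma_s\}_{s\in S}$ is linearly independent if and only if the matrix $A$ is invertible, if and only if $V$ is semisimple. (2) When $V$ is semisimple, $V^*=\bigoplus_s\mathbb{C}\gamma_s$ is an IR-representation of $W$, and it corresponds to the data $((k_{rt})_{r,t},\chi^* )$, where $\chi^*$ is the dual character $\chi^*(-)=\chi(-)^{-1}$. (3) In general, $\{\gamma_s\}_{s\in S}$ spans a sub-representation $V_1:=\sum_{s\in S}\mathbb{C}\gamma_s$ of $V^*$. Moreover, $V_1$ is an R-representation isomorphic to the semisimple quotient of the IR-representation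 corresponding to the data $((k_{rt})_{r,t},\chi^* )$, and the action of $W$ on the quotient $V^*/V_1$ is trivial.
   Context: $W=\langle S\mid s^2=(st)^{m_{st}}=e,\ \forall s\ne t\in S\rangle$. All representations are complex. IR-representation: a representation $V$ of $W$ having a basis $\{\alpha_s\mid s\in S\}$ such that for every $s\in S$ there is a subspace $H_s$ of codimension $1$ with $s|_{H_s}=\mathrm{Id}_{H_s}$, and $s\cdot\alpha_s=-\alpha_s$. Every such $V$ is defined by a datum $(k_{rt},a_r^t)_{r\neq t}$ with $k_{rt}=k_{tr}\in\mathbb{N}$, $1\le k_{rt}\le m_{rt}/2$, $a_r^t\in\mathbb{C}^\times$, via $r\cdot\alpha_r=-\alpha_r$ and $r\cdot\alpha_t=\alpha_t+2\frac{a_r^t}{a_t^r}\cos\frac{k_{rt}\pi}{m_{rt}}\alpha_r$ for $t\ne r$. $\widetilde G$ is the graph with vertex set $S$ in which $\{r,t\}$ is an edge iff $m_{rt}/\gcd(m_{rt},k_{rt})\ge3$ (equivalently $k_{rt}\ne m_{rt}/2$). $\mathrm{H}_1(\widetilde G)$ is its first integral homology (as a 1-dimensional simplicial complex), and the character $\chi:\mathrm{H}_1(\widetilde G)\to\mathbb{C}^\times$ attached to $V$ is the restriction of the homomorphism on 1-chains sending the oriented edge $(r,t)$ to $a_t^r/a_r^t$. Isomorphism classes of IR-representations correspond bijectively to data $((k_{rt}),\chi)$ with $1\le k_{rt}=k_{tr}\le m_{rt}/2$ and $\chi$ a character of $\mathrm{H}_1(\widetilde G)$. R-representation: a representation of $W$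 spanned by nonzero vectors $\{\alpha_s\mid s\in S\}$ such that for every $s\in S$ there is a subspace $H_s$ of codimension $1$ with $s|_{H_s}=\mathrm{Id}_{H_s}$ and $s\cdot\alpha_s=-\alpha_s$, and for all $r\neq t\in S$ with $m_{rt}<\infty$ the vectors $\alpha_r,\alpha_t$ are linearly independent. Semisimple quotient of an IR-representation $V'=\bigoplus_s\mathbb{C}\alpha'_s$: if $S=\sqcup_iS_i$ is the decomposition of $\widetilde G$ into connected components, then $V'=\bigoplus_iV'_i$ with sub-representations $V'_i=\bigoplus_{s\in S_i}\mathbb{C}\alpha'_s$; let $V'_{i,0}$ be the maximal proper sub-representation of $V'_i$ (zero if $V'_i$ is irreducible; it always has trivial $W$-action). The semisimple quotient is $V'/\bigoplus_iV'_{i,0}$. *)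

theory Defs
  imports Complex_Main "HOL-Algebra.Generated_Groups" "HOL-Library.Function_Algebras"
begin

section \<open>Coxeter systems\<close>

text \<open>The entry \<open>m s t = 0\<close> encodes \<open>m\<^sub>s\<^sub>t = \<infinity>\<close>, i.e. the absence of a relation.\<close>

definition coxeter_matrix :: "'g set \<Rightarrow> ('g \<Rightarrow> 'g \<Rightarrow> nat) \<Rightarrow> bool" where
  "coxeter_matrix S m \<longleftrightarrow>
     (\<forall>s\<in>S. m s s = 1) \<and>
     (\<forall>s\<in>S. \<forall>t\<in>S. s \<noteq> t \<longrightarrow> m s t = m t s \<and> m s t \<noteq> 1)"

text \<open>The congruence on words over \<open>S\<close> generated by the relators \<open>ss\<close> and \<open>(st)\<^sup>m\<close>.  As the
  letters are involutions, the monoid presented in this way is the group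
  \<open>\<langle>S | s\<^sup>2 = (st)\<^sup>m = e\<rangle>\<close>.\<close>

inductive cox_eq :: "'g set \<Rightarrow> ('g \<Rightarrow> 'g \<Rightarrow> nat) \<Rightarrow> 'g list \<Rightarrow> 'g list \<Rightarrow> bool"
  for S :: "'g set" and m :: "'g \<Rightarrow> 'g \<Rightarrow> nat" where
  cox_refl: "w \<in> lists S \<Longrightarrow> cox_eq S m w w"
| cox_sym: "cox_eq S m w w' \<Longrightarrow> cox_eq S m w' w"
| cox_trans: "cox_eq S m w w' \<Longrightarrow> cox_eq S m w' w'' \<Longrightarrow> cox_eq S m w w''"
| cox_square: "u \<in> lists S \<Longrightarrow> v \<in> lists S \<Longrightarrow> s \<in> S \<Longrightarrow>
     cox_eq S m (u @ [s, s] @ v) (u @ v)"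
| cox_braid: "u \<in> lists S \<Longrightarrow> v \<in> lists S \<Longrightarrow> s \<in> S \<Longrightarrow> t \<in> S \<Longrightarrow> s \<noteq> t \<Longrightarrow>
     cox_eq S m (u @ concat (replicate (m s t) [s, t]) @ v) (u @ v)"

definition coxeter_system ::
  "('g, 'z) monoid_scheme \<Rightarrow> 'g set \<Rightarrow> ('g \<Rightarrow> 'g \<Rightarrow> nat) \<Rightarrow> bool" where
  "coxeter_system W S m \<longleftrightarrow>
     group W \<and> S \<subseteq> carrier W \<and> coxeter_matrix S m \<and> generate W S = carrier W \<and>
     (\<forall>w\<in>lists S. foldr (\<otimes>\<^bsub>W\<^esub>) w \<one>\<^bsub>W\<^esub> = \<one>\<^bsub>W\<^esub> \<longleftrightarrow> cox_eq S m w [])"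


section \<open>Complex representations\<close>

text \<open>A representation lives on a linear subspace \<open>V\<close> of an ambient complex vector space with
  scalar multiplication \<open>scale\<close>; the operators \<open>\<rho> g\<close> are only constrained on \<open>V\<close>.\<close>

definition group_rep ::
  "('g, 'z) monoid_scheme \<Rightarrow> (complex \<Rightarrow> 'v::ab_group_add \<Rightarrow> 'v) \<Rightarrow> 'v set \<Rightarrow> ('g \<Rightarrow> 'v \<Rightarrow> 'v) \<Rightarrow> bool"
  where
  "group_rep W scale V \<rho> \<longleftrightarrow>
     vector_space scale \<and> module.subspace scale V \<and>
     (\<forall>g\<in>carrier W. \<forall>v\<in>V. \<rho> g v \<in> V) \<and>
     (\<forall>g\<in>carrier W. \<forall>v\<in>V. \<forall>w\<in>V. \<rho> g (v + w) = \<rho> g v + \<rho> g w) \<and>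
     (\<forall>g\<in>carrier W. \<forall>c. \<forall>v\<in>V. \<rho> g (scale c v) = scale c (\<rho> g v)) \<and>
     (\<forall>v\<in>V. \<rho> \<one>\<^bsub>W\<^esub> v = v) \<and>
     (\<forall>g\<in>carrier W. \<forall>h\<in>carrier W. \<forall>v\<in>V. \<rho> (g \<otimes>\<^bsub>W\<^esub> h) v = \<rho> g (\<rho> h v))"

definition subrep ::
  "('g, 'z) monoid_scheme \<Rightarrow> (complex \<Rightarrow> 'v::ab_group_add \<Rightarrow> 'v) \<Rightarrow> 'v set \<Rightarrow> ('g \<Rightarrow> 'v \<Rightarrow> 'v) \<Rightarrow>
   'v set \<Rightarrow> bool" where
  "subrep W scale V \<rho> U \<longleftrightarrow>
     module.subspace scale U \<and> U \<subseteq> V \<and> (\<forall>g\<in>carrier W. \<forall>u\<in>U. \<rho> g u \<in> U)"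

definition irreducible_rep ::
  "('g, 'z) monoid_scheme \<Rightarrow> (complex \<Rightarrow> 'v::ab_group_add \<Rightarrow> 'v) \<Rightarrow> 'v set \<Rightarrow> ('g \<Rightarrow> 'v \<Rightarrow> 'v) \<Rightarrow> bool"
  where
  "irreducible_rep W scale V \<rho> \<longleftrightarrow>
     V \<noteq> {0} \<and> (\<forall>U. subrep W scale V \<rho> U \<longrightarrow> U = {0} \<or> U = V)"

text \<open>\<open>V\<close> is the direct sum of irreducible sub-representations.  The summands are nonzero and
  independent, hence pairwise distinct, so a set of subspaces suffices.\<close>

definition semisimple_rep ::
  "('g, 'z) monoid_scheme \<Rightarrow> (complex \<Rightarrow> 'v::ab_group_add \<Rightarrow> 'v) \<Rightarrow> 'v set \<Rightarrow> ('g \<Rightarrow> 'v \<Rightarrow> 'v) \<Rightarrow> bool"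
  where
  "semisimple_rep W scale V \<rho> \<longleftrightarrow>
     (\<exists>\<U>. (\<forall>U\<in>\<U>. subrep W scale V \<rho> U \<and> irreducible_rep W scale U \<rho>) \<and>
          module.span scale (\<Union>\<U>) = V \<and>
          (\<forall>U\<in>\<U>. U \<inter> module.span scale (\<Union>(\<U> - {U})) = {0}))"

definition max_proper_subrep ::
  "('g, 'z) monoid_scheme \<Rightarrow> (complex \<Rightarrow> 'v::ab_group_add \<Rightarrow> 'v) \<Rightarrow> 'v set \<Rightarrow> ('g \<Rightarrow> 'v \<Rightarrow> 'v) \<Rightarrow> 'v set"
  where
  "max_proper_subrep W scale V \<rho> =
     (THE U. subrep W scale V \<rho> U \<and> U \<noteq> V \<and>
             (\<forall>U'. subrep W scale V \<rho> U' \<and> U' \<noteq> V \<longrightarrow> U' \<subseteq> U))"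

definition fam_independent ::
  "(complex \<Rightarrow> 'v::ab_group_add \<Rightarrow> 'v) \<Rightarrow> 'i set \<Rightarrow> ('i \<Rightarrow> 'v) \<Rightarrow> bool" where
  "fam_independent scale I \<alpha> \<longleftrightarrow> inj_on \<alpha> I \<and> \<not> module.dependent scale (\<alpha> ` I)"

definition fam_basis ::
  "(complex \<Rightarrow> 'v::ab_group_add \<Rightarrow> 'v) \<Rightarrow> 'v set \<Rightarrow> 'i set \<Rightarrow> ('i \<Rightarrow> 'v) \<Rightarrow> bool" where
  "fam_basis scale V I \<alpha> \<longleftrightarrow> fam_independent scale I \<alpha> \<and> module.span scale (\<alpha> ` I) = V"


subsection \<open>Quotient representations\<close>

definition vcoset :: "'v::ab_group_add set \<Rightarrow> 'v \<Rightarrow> 'v set" where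
  "vcoset N v = {v + n | n. n \<in> N}"

definition quot_space :: "'v::ab_group_add set \<Rightarrow> 'v set \<Rightarrow> 'v set set" where
  "quot_space V N = vcoset N ` V"

definition quot_add :: "'v::ab_group_add set \<Rightarrow> 'v set \<Rightarrow> 'v set" where
  "quot_add X Y = {x + y | x y. x \<in> X \<and> y \<in> Y}"

text \<open>Adding \<open>N\<close> makes the result a full coset also for the scalar \<open>0\<close>.\<close>

definition quot_scale ::
  "(complex \<Rightarrow> 'v::ab_group_add \<Rightarrow> 'v) \<Rightarrow> 'v set \<Rightarrow> complex \<Rightarrow> 'v set \<Rightarrow> 'v set" where
  "quot_scale scale N c X = {scale c x + n | x n. x \<in> X \<and> n \<in> N}"

definition quot_act ::
  "('g \<Rightarrow> 'v::ab_group_add \<Rightarrow> 'v) \<Rightarrow> 'v set \<Rightarrow> 'g \<Rightarrow> 'v set \<Rightarrow> 'v set" where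
  "quot_act \<rho> N g X = {\<rho> g x + n | x n. x \<in> X \<and> n \<in> N}"

text \<open>The quotient representation \<open>V/N\<close> is isomorphic to the representation \<open>V'\<close>.\<close>

definition quot_rep_iso ::
  "('g, 'z) monoid_scheme \<Rightarrow>
   (complex \<Rightarrow> 'v::ab_group_add \<Rightarrow> 'v) \<Rightarrow> 'v set \<Rightarrow> ('g \<Rightarrow> 'v \<Rightarrow> 'v) \<Rightarrow> 'v set \<Rightarrow>
   (complex \<Rightarrow> 'w::ab_group_add \<Rightarrow> 'w) \<Rightarrow> 'w set \<Rightarrow> ('g \<Rightarrow> 'w \<Rightarrow> 'w) \<Rightarrow> bool" where
  "quot_rep_iso W scale V \<rho> N scale' V' \<rho>' \<longleftrightarrow>
     (\<exists>f. bij_betw f (quot_space V N) V' \<and>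
          (\<forall>X\<in>quot_space V N. \<forall>Y\<in>quot_space V N. f (quot_add X Y) = f X + f Y) \<and>
          (\<forall>c. \<forall>X\<in>quot_space V N. f (quot_scale scale N c X) = scale' c (f X)) \<and>
          (\<forall>g\<in>carrier W. \<forall>X\<in>quot_space V N. f (quot_act \<rho> N g X) = \<rho>' g (f X)))"


subsection \<open>The dual representation\<close>

definition fun_scale :: "complex \<Rightarrow> ('v \<Rightarrow> complex) \<Rightarrow> 'v \<Rightarrow> complex" where
  "fun_scale c f = (\<lambda>v. c * f v)"

definition dual_space :: "(complex \<Rightarrow> 'v::ab_group_add \<Rightarrow> 'v) \<Rightarrow> ('v \<Rightarrow> complex) set" where
  "dual_space scale = {f. Vector_Spaces.linear scale (*) f}"

text \<open>For an involution \<open>s\<close> this is \<open>(s \<cdot> f)(v) = f(s \<cdot> v)\<close>.\<close>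

definition dual_act ::
  "('g, 'z) monoid_scheme \<Rightarrow> ('g \<Rightarrow> 'v \<Rightarrow> 'v) \<Rightarrow> 'g \<Rightarrow> ('v \<Rightarrow> complex) \<Rightarrow> 'v \<Rightarrow> complex" where
  "dual_act W \<rho> g f = (\<lambda>v. f (\<rho> (inv\<^bsub>W\<^esub> g) v))"


section \<open>IR-representations and R-representations\<close>

text \<open>Only used for finite \<open>S\<close>, where all spaces involved are finite-dimensional and
  \<open>vector_space.dim\<close> is the genuine dimension.\<close>

definition acts_as_reflection ::
  "(complex \<Rightarrow> 'v::ab_group_add \<Rightarrow> 'v) \<Rightarrow> 'v set \<Rightarrow> ('v \<Rightarrow> 'v) \<Rightarrow> 'v \<Rightarrow> bool" where
  "acts_as_reflection scale V f a \<longleftrightarrow>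
     (\<exists>H. module.subspace scale H \<and> H \<subseteq> V \<and>
          vector_space.dim scale V = vector_space.dim scale H + 1 \<and> (\<forall>v\<in>H. f v = v)) \<and>
     f a = - a"

definition ir_rep ::
  "('g, 'z) monoid_scheme \<Rightarrow> 'g set \<Rightarrow> (complex \<Rightarrow> 'v::ab_group_add \<Rightarrow> 'v) \<Rightarrow> 'v set \<Rightarrow>
   ('g \<Rightarrow> 'v \<Rightarrow> 'v) \<Rightarrow> ('g \<Rightarrow> 'v) \<Rightarrow> bool" where
  "ir_rep W S scale V \<rho> \<alpha> \<longleftrightarrow>
     group_rep W scale V \<rho> \<and> fam_basis scale V S \<alpha> \<and>
     (\<forall>s\<in>S. acts_as_reflection scale V (\<rho> s) (\<alpha> s))"

definition r_rep ::
  "('g, 'z) monoid_scheme \<Rightarrow> 'g set \<Rightarrow> ('g \<Rightarrow> 'g \<Rightarrow> nat) \<Rightarrow> (complex \<Rightarrow> 'v::ab_group_add \<Rightarrow> 'v) \<Rightarrow>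
   'v set \<Rightarrow> ('g \<Rightarrow> 'v \<Rightarrow> 'v) \<Rightarrow> ('g \<Rightarrow> 'v) \<Rightarrow> bool" where
  "r_rep W S m scale V \<rho> \<alpha> \<longleftrightarrow>
     group_rep W scale V \<rho> \<and> module.span scale (\<alpha> ` S) = V \<and>
     (\<forall>s\<in>S. \<alpha> s \<noteq> 0 \<and> acts_as_reflection scale V (\<rho> s) (\<alpha> s)) \<and>
     (\<forall>r\<in>S. \<forall>t\<in>S. r \<noteq> t \<and> m r t \<noteq> 0 \<longrightarrow> fam_independent scale {r, t} \<alpha>)"


subsection \<open>The datum of an IR-representation\<close>

text \<open>From here on all \<open>m r t\<close> are finite.  The parameter \<open>a\<^sub>r\<^sup>t\<close> is written \<open>a r t\<close>.\<close>

definition ir_datum ::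
  "'g set \<Rightarrow> ('g \<Rightarrow> 'g \<Rightarrow> nat) \<Rightarrow> ('g \<Rightarrow> 'g \<Rightarrow> nat) \<Rightarrow> ('g \<Rightarrow> 'g \<Rightarrow> complex) \<Rightarrow> bool" where
  "ir_datum S m k a \<longleftrightarrow>
     (\<forall>r\<in>S. \<forall>t\<in>S. r \<noteq> t \<longrightarrow>
        k r t = k t r \<and> 1 \<le> k r t \<and> real (k r t) \<le> real (m r t) / 2 \<and> a r t \<noteq> 0)"

definition cos_coeff ::
  "('g \<Rightarrow> 'g \<Rightarrow> nat) \<Rightarrow> ('g \<Rightarrow> 'g \<Rightarrow> nat) \<Rightarrow> ('g \<Rightarrow> 'g \<Rightarrow> complex) \<Rightarrow> 'g \<Rightarrow> 'g \<Rightarrow> complex" where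
  "cos_coeff m k a r t = a r t / a t r * of_real (cos (real (k r t) * pi / real (m r t)))"

definition ir_rep_of_datum ::
  "('g, 'z) monoid_scheme \<Rightarrow> 'g set \<Rightarrow> ('g \<Rightarrow> 'g \<Rightarrow> nat) \<Rightarrow> (complex \<Rightarrow> 'v::ab_group_add \<Rightarrow> 'v) \<Rightarrow>
   'v set \<Rightarrow> ('g \<Rightarrow> 'v \<Rightarrow> 'v) \<Rightarrow> ('g \<Rightarrow> 'v) \<Rightarrow> ('g \<Rightarrow> 'g \<Rightarrow> nat) \<Rightarrow> ('g \<Rightarrow> 'g \<Rightarrow> complex) \<Rightarrow> bool" where
  "ir_rep_of_datum W S m scale V \<rho> \<alpha> k a \<longleftrightarrow>
     ir_rep W S scale V \<rho> \<alpha> \<and> ir_datum S m k a \<and>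
     (\<forall>r\<in>S. \<rho> r (\<alpha> r) = - \<alpha> r) \<and>
     (\<forall>r\<in>S. \<forall>t\<in>S. r \<noteq> t \<longrightarrow> \<rho> r (\<alpha> t) = \<alpha> t + scale (2 * cos_coeff m k a r t) (\<alpha> r))"


subsection \<open>The graph and its first homology\<close>

text \<open>The set of oriented edges of the graph attached to \<open>k\<close>; it is symmetric.\<close>

definition ir_edges ::
  "'g set \<Rightarrow> ('g \<Rightarrow> 'g \<Rightarrow> nat) \<Rightarrow> ('g \<Rightarrow> 'g \<Rightarrow> nat) \<Rightarrow> ('g \<times> 'g) set" where
  "ir_edges S m k =
     {(r, t). r \<in> S \<and> t \<in> S \<and> r \<noteq> t \<and> m r t div gcd (m r t) (k r t) \<ge> 3}"

definition graph_components :: "'g set \<Rightarrow> ('g \<times> 'g) set \<Rightarrow> 'g set set" where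
  "graph_components S E = {{t \<in> S. (r, t) \<in> E\<^sup>*} | r. r \<in> S}"

text \<open>Simplicial 1-chains: integer combinations of oriented edges modulo \<open>[r,t] = -[t,r]\<close>,
  realised as antisymmetric functions.  There are no 2-simplices, so the first homology group is
  the group of 1-cycles; the boundary of \<open>c\<close> has coefficient \<open>\<Sum>\<^sub>r c (r, v)\<close> at the vertex \<open>v\<close>.\<close>

definition one_chains :: "('g \<times> 'g) set \<Rightarrow> ('g \<times> 'g \<Rightarrow> int) set" where
  "one_chains E = {c. (\<forall>r t. c (t, r) = - c (r, t)) \<and> (\<forall>e. e \<notin> E \<longrightarrow> c e = 0)}"

definition edge_chain :: "'g \<Rightarrow> 'g \<Rightarrow> 'g \<times> 'g \<Rightarrow> int" where
  "edge_chain r t = (\<lambda>e. of_bool (e = (r, t)) - of_bool (e = (t, r)))"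

definition H1 :: "'g set \<Rightarrow> ('g \<times> 'g) set \<Rightarrow> ('g \<times> 'g \<Rightarrow> int) set" where
  "H1 S E = {c \<in> one_chains E. \<forall>v\<in>S. (\<Sum>r\<in>S. c (r, v)) = 0}"

definition character_on ::
  "('g \<times> 'g \<Rightarrow> int) set \<Rightarrow> (('g \<times> 'g \<Rightarrow> int) \<Rightarrow> complex) \<Rightarrow> bool" where
  "character_on C \<phi> \<longleftrightarrow>
     (\<forall>c\<in>C. \<phi> c \<noteq> 0) \<and> (\<forall>c\<in>C. \<forall>d\<in>C. \<phi> (c + d) = \<phi> c * \<phi> d)"

text \<open>\<open>\<chi>\<close> is, on the homology group, the restriction of the homomorphism \<open>\<phi>\<close> on 1-chains with
  \<open>\<phi>([r,t]) = a\<^sub>t\<^sup>r / a\<^sub>r\<^sup>t\<close>.  Values of \<open>\<chi>\<close> off the cycles are irrelevant.\<close>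

definition character_of_datum ::
  "'g set \<Rightarrow> ('g \<Rightarrow> 'g \<Rightarrow> nat) \<Rightarrow> ('g \<Rightarrow> 'g \<Rightarrow> nat) \<Rightarrow> ('g \<Rightarrow> 'g \<Rightarrow> complex) \<Rightarrow>
   (('g \<times> 'g \<Rightarrow> int) \<Rightarrow> complex) \<Rightarrow> bool" where
  "character_of_datum S m k a \<chi> \<longleftrightarrow>
     (\<exists>\<phi>. character_on (one_chains (ir_edges S m k)) \<phi> \<and>
          (\<forall>(r, t)\<in>ir_edges S m k. \<phi> (edge_chain r t) = a t r / a r t) \<and>
          (\<forall>c\<in>H1 S (ir_edges S m k). \<chi> c = \<phi> c))"

definition ir_rep_of_data ::
  "('g, 'z) monoid_scheme \<Rightarrow> 'g set \<Rightarrow> ('g \<Rightarrow> 'g \<Rightarrow> nat) \<Rightarrow> (complex \<Rightarrow> 'v::ab_group_add \<Rightarrow> 'v) \<Rightarrow>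
   'v set \<Rightarrow> ('g \<Rightarrow> 'v \<Rightarrow> 'v) \<Rightarrow> ('g \<Rightarrow> 'v) \<Rightarrow> ('g \<Rightarrow> 'g \<Rightarrow> nat) \<Rightarrow>
   (('g \<times> 'g \<Rightarrow> int) \<Rightarrow> complex) \<Rightarrow> bool" where
  "ir_rep_of_data W S m scale V \<rho> \<alpha> k \<chi> \<longleftrightarrow>
     (\<exists>a. ir_rep_of_datum W S m scale V \<rho> \<alpha> k a \<and> character_of_datum S m k a \<chi>)"

definition dual_character ::
  "(('g \<times> 'g \<Rightarrow> int) \<Rightarrow> complex) \<Rightarrow> ('g \<times> 'g \<Rightarrow> int) \<Rightarrow> complex" where
  "dual_character \<chi> = (\<lambda>c. inverse (\<chi> c))"


subsection \<open>The semisimple quotient\<close>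

text \<open>The sum of the maximal proper sub-representations of the summands attached to the connected
  components; the semisimple quotient is the quotient by this subspace.\<close>

definition semisimple_kernel ::
  "('g, 'z) monoid_scheme \<Rightarrow> 'g set \<Rightarrow> ('g \<Rightarrow> 'g \<Rightarrow> nat) \<Rightarrow> (complex \<Rightarrow> 'v::ab_group_add \<Rightarrow> 'v) \<Rightarrow>
   ('g \<Rightarrow> 'v \<Rightarrow> 'v) \<Rightarrow> ('g \<Rightarrow> 'v) \<Rightarrow> ('g \<Rightarrow> 'g \<Rightarrow> nat) \<Rightarrow> 'v set" where
  "semisimple_kernel W S m scale \<rho> \<alpha> k =
     module.span scale
       (\<Union>C\<in>graph_components S (ir_edges S m k).
          max_proper_subrep W scale (module.span scale (\<alpha> ` C)) \<rho>)"


section \<open>The vectors \<open>\<gamma>\<^sub>s\<close> and the matrix \<open>A\<close>\<close>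

definition gamma ::
  "'g set \<Rightarrow> ('g \<Rightarrow> 'g \<Rightarrow> nat) \<Rightarrow> ('g \<Rightarrow> 'g \<Rightarrow> nat) \<Rightarrow> ('g \<Rightarrow> 'g \<Rightarrow> complex) \<Rightarrow>
   ('g \<Rightarrow> 'v \<Rightarrow> complex) \<Rightarrow> 'g \<Rightarrow> 'v \<Rightarrow> complex" where
  "gamma S m k a \<alpha>d s = \<alpha>d s - (\<Sum>t\<in>S - {s}. fun_scale (cos_coeff m k a s t) (\<alpha>d t))"

definition cos_matrix ::
  "('g \<Rightarrow> 'g \<Rightarrow> nat) \<Rightarrow> ('g \<Rightarrow> 'g \<Rightarrow> nat) \<Rightarrow> ('g \<Rightarrow> 'g \<Rightarrow> complex) \<Rightarrow> 'g \<Rightarrow> 'g \<Rightarrow> complex" where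
  "cos_matrix m k a s t = (if s = t then 1 else - cos_coeff m k a s t)"

definition matrix_invertible_on :: "'i set \<Rightarrow> ('i \<Rightarrow> 'i \<Rightarrow> complex) \<Rightarrow> bool" where
  "matrix_invertible_on I A \<longleftrightarrow>
     (\<exists>B. \<forall>i\<in>I. \<forall>j\<in>I. (\<Sum>l\<in>I. A i l * B l j) = of_bool (i = j) \<and>
                        (\<Sum>l\<in>I. B i l * A l j) = of_bool (i = j))"

end

theory Submission
  imports Defs
begin

text \<open>
  In coordinates a generator acts by \<open>s v = v - 2 f\<^sub>s(v) \<alpha>\<^sub>s\<close>, where \<open>f\<^sub>s\<close> is the linear form given by
  the row \<open>s\<close> of \<open>A\<close>; this form is \<open>\<gamma>\<^sub>s\<close>.  Hence a sub-representation that contains a vector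
  not killed by \<open>f\<^sub>s\<close> contains \<open>\<alpha>\<^sub>s\<close>, and with it the whole component of \<open>s\<close>.  So each
  maximal proper sub-representation of a component is its space of fixed vectors, the semisimple
  kernel is the common kernel of the \<open>f\<^sub>s\<close>, and semisimplicity means that this kernel vanishes.

  Dually \<open>s g = g - 2 g(\<alpha>\<^sub>s) \<gamma>\<^sub>s\<close> on \<open>V\<^sup>*\<close>, so that \<open>W\<close> acts trivially modulo the span of
  the \<open>\<gamma>\<^sub>s\<close>, and the \<open>\<gamma>\<^sub>s\<close> transform by the transposed datum \<open>a\<^sub>t\<^sup>r\<close>.  A representation with
  data \<open>(k, \<chi>\<^sup>*)\<close> differs from the transposed datum by a rescaling of the basis: the product of the
  two characters is trivial on cycles, hence the coboundary of a potential \<open>d\<close> on the vertices.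
  The map \<open>\<alpha>'\<^sub>s \<mapsto> d\<^sub>s \<gamma>\<^sub>s\<close> is then an intertwiner whose kernel is the space of fixed vectors.
\<close>

section \<open>Linear algebra\<close>

context vector_space
begin

text \<open>The family \<open>e\<close> may repeat vectors, so coefficients are attached to indices
  and not to the vectors of the image. The combinations form a subspace that contains the
  image.\<close>

lemma in_span_family_iff:
  assumes "finite I"
  shows "v \<in> span (e ` I) \<longleftrightarrow> (\<exists>c. v = (\<Sum>i\<in>I. scale (c i) (e i)))"
proof
  let ?U = "{v. \<exists>c. v = (\<Sum>i\<in>I. scale (c i) (e i))}"
  have "subspace ?U"
  proof (rule subspaceI)
    show "0 \<in> ?U" by (auto intro!: exI[of _ "\<lambda>_. 0"])
  next
    fix x y assume "x \<in> ?U" "y \<in> ?U"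
    then obtain c d where "x = (\<Sum>i\<in>I. scale (c i) (e i))" "y = (\<Sum>i\<in>I. scale (d i) (e i))"
      by auto
    then show "x + y \<in> ?U"
      by (auto simp: scale_left_distrib sum.distrib intro!: exI[of _ "\<lambda>i. c i + d i"])
  next
    fix r x assume "x \<in> ?U"
    then obtain c where "x = (\<Sum>i\<in>I. scale (c i) (e i))" by auto
    then show "scale r x \<in> ?U"
      by (auto simp: scale_sum_right intro!: exI[of _ "\<lambda>i. r * c i"])
  qed
  moreover have "e ` I \<subseteq> ?U"
  proof safe
    fix i assume "i \<in> I"
    have "(\<Sum>j\<in>I. scale (of_bool (j = i)) (e j)) = (\<Sum>j\<in>{i}. scale (of_bool (j = i)) (e j))"
      using \<open>i \<in> I\<close> assms by (intro sum.mono_neutral_right) auto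
    then show "\<exists>c. e i = (\<Sum>j\<in>I. scale (c j) (e j))"
      by (intro exI[of _ "\<lambda>j. of_bool (j = i)"]) simp
  qed
  ultimately have "span (e ` I) \<subseteq> ?U" by (rule span_minimal[rotated])
  then show "v \<in> span (e ` I) \<Longrightarrow> \<exists>c. v = (\<Sum>i\<in>I. scale (c i) (e i))" by auto
next
  assume "\<exists>c. v = (\<Sum>i\<in>I. scale (c i) (e i))"
  then show "v \<in> span (e ` I)" by (auto intro!: span_sum span_scale intro: span_base)
qed

end

text \<open>Passes from the set-based notion to coefficients attached to indices. A repetition
  \<open>e i = e j\<close> already violates the right-hand side through the relation
  \<open>e i - e j = 0\<close>, which is where \<open>inj_on\<close> comes from.\<close>

lemma fam_independent_iff:
  assumes "vector_space scale" "finite I"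
  shows "fam_independent scale I e \<longleftrightarrow>
    (\<forall>c. (\<Sum>i\<in>I. scale (c i) (e i)) = 0 \<longrightarrow> (\<forall>i\<in>I. c i = 0))"
proof -
  interpret vector_space scale by fact
  show ?thesis
  proof
    assume ind: "fam_independent scale I e"
    show "\<forall>c. (\<Sum>i\<in>I. scale (c i) (e i)) = 0 \<longrightarrow> (\<forall>i\<in>I. c i = 0)"
    proof safe
      fix c i assume 0: "(\<Sum>i\<in>I. scale (c i) (e i)) = 0" and "i \<in> I"
      have inj: "inj_on e I" and "independent (e ` I)" using ind by (auto simp: fam_independent_def)
      have "(\<Sum>v\<in>e ` I. scale (c (the_inv_into I e v)) v) = 0"
        using 0 by (simp add: sum.reindex[OF inj] the_inv_into_f_f[OF inj])
      then have "c (the_inv_into I e (e i)) = 0"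
        using independentD[of "e ` I" "e ` I" "\<lambda>v. c (the_inv_into I e v)"] \<open>independent (e ` I)\<close> \<open>i \<in> I\<close> assms(2) by blast
      then show "c i = 0" using the_inv_into_f_f[OF inj \<open>i \<in> I\<close>] by simp
    qed
  next
    assume R: "\<forall>c. (\<Sum>i\<in>I. scale (c i) (e i)) = 0 \<longrightarrow> (\<forall>i\<in>I. c i = 0)"
    have inj: "inj_on e I"
    proof (rule inj_onI, rule ccontr)
      fix i j assume ij: "i \<in> I" "j \<in> I" "e i = e j" "i \<noteq> j"
      define c :: "_ \<Rightarrow> complex" where "c = (\<lambda>x. of_bool (x = i) - of_bool (x = j))"
      have "(\<Sum>x\<in>I. scale (c x) (e x)) = (\<Sum>x\<in>{i, j}. scale (c x) (e x))"
        using ij assms(2) by (intro sum.mono_neutral_right) (auto simp: c_def)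
      also have "\<dots> = 0" using ij by (simp add: c_def)
      finally have "c i = 0" using R ij by blast
      then show False using ij by (simp add: c_def)
    qed
    have "independent (e ` I)"
    proof (rule independent_if_scalars_zero)
      fix f x assume "(\<Sum>x\<in>e ` I. scale (f x) x) = 0" "x \<in> e ` I"
      then show "f x = 0" using R[rule_format, of "f \<circ> e"] by (auto simp: sum.reindex[OF inj])
    qed (use assms in auto)
    then show "fam_independent scale I e" using inj by (simp add: fam_independent_def)
  qed
qed

text \<open>A count: a member of \<open>e\<close> outside the span of the family \<open>b\<close>
  would extend \<open>b\<close> to an independent family with more than \<open>card I\<close>
  members inside the span of \<open>e\<close>.\<close>

lemma fam_independent_span_eq:
  assumes "vector_space scale" "finite I" "fam_independent scale I e" "fam_independent scale I b"
    and "b ` I \<subseteq> module.span scale (e ` I)"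
  shows "module.span scale (b ` I) = module.span scale (e ` I)"
proof -
  interpret vector_space scale by fact
  have ind: "independent (b ` I)" and card: "card (b ` I) = card (e ` I)"
    using assms(3,4) by (auto simp: fam_independent_def card_image)
  have "e ` I \<subseteq> span (b ` I)"
  proof (rule ccontr)
    assume "\<not> e ` I \<subseteq> span (b ` I)"
    then obtain x where x: "x \<in> e ` I" "x \<notin> span (b ` I)" by blast
    then have "independent (insert x (b ` I))" using ind by (simp add: independent_insertI)
    moreover have "insert x (b ` I) \<subseteq> span (e ` I)" using x assms(5) span_base by blast
    ultimately have "card (insert x (b ` I)) \<le> card (e ` I)"
      using independent_span_bound[of "e ` I"] assms(2) by blast
    moreover have "x \<notin> b ` I" using x(2) span_base by blast
    ultimately show False using card assms(2) by simp
  qed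
  then show ?thesis using assms(5) by (simp add: span_eq)
qed

lemma matrix_invertible_on_transpose:
  "matrix_invertible_on I (\<lambda>i j. A j i) \<longleftrightarrow> matrix_invertible_on I A"
proof -
  have *: "matrix_invertible_on I (\<lambda>i j. A j i)" if inv: "matrix_invertible_on I A" for A
  proof -
    obtain B where "\<forall>i\<in>I. \<forall>j\<in>I. (\<Sum>l\<in>I. A i l * B l j) = of_bool (i = j) \<and>
        (\<Sum>l\<in>I. B i l * A l j) = of_bool (i = j)"
      using inv unfolding matrix_invertible_on_def by blast
    then show ?thesis unfolding matrix_invertible_on_def
      by (intro exI[of _ "\<lambda>i j. B j i"]) (auto simp: mult.commute)
  qed
  show ?thesis using *[of A] *[of "\<lambda>i j. A j i"] by blast
qed

text \<open>An independent \<open>b\<close> spans the same space as \<open>e\<close> by counting, so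
  \<open>e\<close> expands in \<open>b\<close> with some matrix \<open>B\<close>; comparing
  coefficients in both families makes \<open>B\<close> a two-sided inverse. Conversely, an inverse
  of \<open>A\<close> recovers the coefficients of a vanishing combination.\<close>

lemma fam_independent_iff_matrix_invertible:
  assumes vs: "vector_space scale" and fin: "finite I" and e: "fam_independent scale I e"
    and b: "\<And>i. i \<in> I \<Longrightarrow> b i = (\<Sum>j\<in>I. scale (A i j) (e j))"
  shows "fam_independent scale I b \<longleftrightarrow> matrix_invertible_on I A"
proof -
  interpret vector_space scale by fact
  have comb: "(\<Sum>i\<in>I. scale (c i) (\<Sum>j\<in>I. scale (B i j) (u j)))
      = (\<Sum>j\<in>I. scale (\<Sum>i\<in>I. c i * B i j) (u j))" for c B u
    by (simp add: scale_sum_right scale_sum_left) (rule sum.swap)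
  have uniq: "\<forall>i\<in>I. c i = d i" if "fam_independent scale I u"
    "(\<Sum>i\<in>I. scale (c i) (u i)) = (\<Sum>i\<in>I. scale (d i) (u i))" for c d u
    using that(2) fam_independent_iff[OF vs fin, THEN iffD1, OF that(1), rule_format,
      of "\<lambda>i. c i - d i"]
    by (auto simp: scale_left_diff_distrib sum_subtractf)
  have unit: "(\<Sum>j\<in>I. scale (of_bool (i = j)) (u j)) = u i" if "i \<in> I" for i u
    using that fin by (subst sum.mono_neutral_right[of I "{i}"]) auto
  show ?thesis
  proof
    assume ind: "fam_independent scale I b"
    have "span (b ` I) = span (e ` I)"
      by (rule fam_independent_span_eq[OF vs fin e ind])
        (auto simp: b intro!: span_sum span_scale intro: span_base)
    then have "\<forall>i. i \<in> I \<longrightarrow> (\<exists>c. e i = (\<Sum>j\<in>I. scale (c j) (b j)))"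
      using in_span_family_iff[OF fin] span_base by blast
    then obtain B where B: "\<And>i. i \<in> I \<Longrightarrow> e i = (\<Sum>j\<in>I. scale (B i j) (b j))"
      by metis
    have 1: "(\<Sum>l\<in>I. B i l * A l j) = of_bool (i = j)" if "i \<in> I" "j \<in> I" for i j
    proof -
      have "(\<Sum>j\<in>I. scale (\<Sum>l\<in>I. B i l * A l j) (e j)) = (\<Sum>l\<in>I. scale (B i l) (b l))"
        unfolding comb[symmetric] by (intro sum.cong refl) (simp flip: b)
      also have "\<dots> = (\<Sum>j\<in>I. scale (of_bool (i = j)) (e j))"
        using B[OF that(1)] unit[OF that(1)] by simp
      finally have "\<forall>j\<in>I. (\<Sum>l\<in>I. B i l * A l j) = of_bool (i = j)" by (rule uniq[OF e])
      then show ?thesis using that(2) by blast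
    qed
    have 2: "(\<Sum>l\<in>I. A i l * B l j) = of_bool (i = j)" if "i \<in> I" "j \<in> I" for i j
    proof -
      have "(\<Sum>j\<in>I. scale (\<Sum>l\<in>I. A i l * B l j) (b j)) = (\<Sum>l\<in>I. scale (A i l) (e l))"
        unfolding comb[symmetric] by (intro sum.cong refl) (simp flip: B)
      also have "\<dots> = (\<Sum>j\<in>I. scale (of_bool (i = j)) (b j))"
        using b[OF that(1)] unit[OF that(1)] by simp
      finally have "\<forall>j\<in>I. (\<Sum>l\<in>I. A i l * B l j) = of_bool (i = j)" by (rule uniq[OF ind])
      then show ?thesis using that(2) by blast
    qed
    show "matrix_invertible_on I A" unfolding matrix_invertible_on_def using 1 2 by blast
  next
    assume "matrix_invertible_on I A"
    then obtain B where B: "\<And>i j. i \<in> I \<Longrightarrow> j \<in> I \<Longrightarrow> (\<Sum>l\<in>I. A i l * B l j) = of_bool (i = j)"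
      unfolding matrix_invertible_on_def by blast
    show "fam_independent scale I b" unfolding fam_independent_iff[OF vs fin]
    proof (rule allI, rule impI)
      fix c assume "(\<Sum>i\<in>I. scale (c i) (b i)) = 0"
      moreover have "(\<Sum>j\<in>I. scale (\<Sum>i\<in>I. c i * A i j) (e j)) = (\<Sum>i\<in>I. scale (c i) (b i))"
        unfolding comb[symmetric] by (intro sum.cong refl) (simp flip: b)
      ultimately have 0: "\<forall>j\<in>I. (\<Sum>i\<in>I. c i * A i j) = 0"
        using fam_independent_iff[OF vs fin, THEN iffD1, OF e, rule_format,
          of "\<lambda>j. \<Sum>i\<in>I. c i * A i j"] by simp
      show "\<forall>i\<in>I. c i = 0"
      proof
        fix i assume "i \<in> I"
        have "c i = (\<Sum>l\<in>I. c l * of_bool (l = i))"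
          using \<open>i \<in> I\<close> fin by (subst sum.mono_neutral_right[of I "{i}"]) auto
        also have "\<dots> = (\<Sum>l\<in>I. c l * (\<Sum>j\<in>I. A l j * B j i))"
          using B \<open>i \<in> I\<close> by (intro sum.cong) auto
        also have "\<dots> = (\<Sum>j\<in>I. (\<Sum>l\<in>I. c l * A l j) * B j i)"
          by (simp add: sum_distrib_left sum_distrib_right mult.assoc) (rule sum.swap)
        finally show "c i = 0" using 0 by simp
      qed
    qed
  qed
qed

text \<open>A basis of \<open>H\<close> together with \<open>x\<close> is a basis of
  \<open>V\<close>. The finite spanning set ensures that the basis of \<open>H\<close> is finite,
  because \<open>card\<close> is 0 on infinite sets.\<close>

lemma (in vector_space) dim_eq_dim_hyperplane:
  assumes H: "subspace H" and fin: "finite B" "H \<subseteq> span B"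
    and x: "x \<notin> H" and V: "\<And>v. v \<in> V \<longleftrightarrow> (\<exists>c. v - scale c x \<in> H)"
  shows "dim V = dim H + 1"
proof -
  obtain C where C: "C \<subseteq> H" "independent C" "H \<subseteq> span C" "card C = dim H"
    by (rule basis_exists)
  have "finite C" using independent_span_bound[OF fin(1) C(2)] C(1) fin(2) by blast
  have "span C = H" using C H by (meson span_minimal subset_antisym)
  then have "x \<notin> span C" using x by simp
  have "dim V = card (insert x C)"
  proof (rule dim_unique)
    have "x \<in> V" using V[of x] H subspace_0 by (auto intro!: exI[of _ 1])
    moreover have "h \<in> V" if "h \<in> C" for h
      using V[of h] that C(1) by (auto intro!: exI[of _ 0])
    ultimately show "insert x C \<subseteq> V" by blast
    show "V \<subseteq> span (insert x C)"
      using V \<open>span C = H\<close> by (auto simp: span_breakdown_eq)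
    show "independent (insert x C)" using \<open>x \<notin> span C\<close> C(2) by (rule independent_insertI)
  qed simp
  moreover have "x \<notin> C" using x C(1) by blast
  ultimately show ?thesis using \<open>finite C\<close> C(4) by simp
qed

lemma fun_scale_apply [simp]: "fun_scale c f v = c * f v"
  by (simp add: fun_scale_def)

global_interpretation fun_scale: vector_space "fun_scale :: complex \<Rightarrow> ('v \<Rightarrow> complex) \<Rightarrow> 'v \<Rightarrow> complex"
  by unfold_locales (auto simp: fun_eq_iff algebra_simps)

lemma sum_fun_apply: "(\<Sum>i\<in>I. f i) v = (\<Sum>i\<in>I. f i v)"
  by (induction I rule: infinite_finite_induct) auto

section \<open>Coxeter groups and words\<close>

locale coxeter_group =
  fixes W :: "('g, 'z) monoid_scheme" (structure) and S :: "'g set" and m :: "'g \<Rightarrow> 'g \<Rightarrow> nat"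
  assumes coxeter: "coxeter_system W S m"

sublocale coxeter_group \<subseteq> group W
  using coxeter by (simp add: coxeter_system_def)

context coxeter_group
begin

abbreviation word_prod :: "'g list \<Rightarrow> 'g" where
  "word_prod w \<equiv> foldr (\<otimes>) w \<one>"

lemma gen_closed [simp, intro]: "s \<in> S \<Longrightarrow> s \<in> carrier W"
  using coxeter by (auto simp: coxeter_system_def)

lemma word_prod_closed [simp, intro]: "w \<in> lists S \<Longrightarrow> word_prod w \<in> carrier W"
  by (induction w) auto

lemma word_prod_append:
  "w \<in> lists S \<Longrightarrow> w' \<in> lists S \<Longrightarrow> word_prod (w @ w') = word_prod w \<otimes> word_prod w'"
  by (induction w) (auto simp: m_assoc)

lemma word_prod_eq_one_iff: "w \<in> lists S \<Longrightarrow> word_prod w = \<one> \<longleftrightarrow> cox_eq S m w []"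
  using coxeter by (auto simp: coxeter_system_def)

lemma gen_square [simp]: "s \<in> S \<Longrightarrow> s \<otimes> s = \<one>"
  using word_prod_eq_one_iff[of "[s, s]"] cox_square[of "[]" S "[]" s m] by simp

lemma gen_inv [simp]: "s \<in> S \<Longrightarrow> inv s = s"
  by (simp add: inv_equality)

lemma word_prod_braid:
  assumes "s \<in> S" "t \<in> S" "s \<noteq> t"
  shows "word_prod (concat (replicate (m s t) [s, t])) = \<one>"
proof -
  have "concat (replicate n [s, t]) \<in> lists S" for n using assms by (induction n) auto
  then show ?thesis
    using word_prod_eq_one_iff cox_braid[of "[]" S "[]" s t m] assms by simp
qed

lemma word_prod_rev: "w \<in> lists S \<Longrightarrow> word_prod (rev w) = inv (word_prod w)"
proof (induction w)
  case (Cons s w)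
  then have "word_prod (rev w @ [s]) = inv (word_prod w) \<otimes> s"
    by (subst word_prod_append) auto
  then show ?case using Cons by (simp add: inv_mult_group)
qed simp

text \<open>Generators are their own inverses, so words without inverse letters suffice.\<close>

lemma obtain_word:
  assumes "g \<in> carrier W"
  obtains w where "w \<in> lists S" "word_prod w = g"
proof -
  have "\<exists>w\<in>lists S. word_prod w = g" if "g \<in> generate W S" for g
    using that
  proof induction
    case one
    show ?case by (auto intro!: bexI[of _ "[]"])
  next
    case (incl s)
    then show ?case by (auto intro!: bexI[of _ "[s]"])
  next
    case (inv s)
    then show ?case by (auto intro!: bexI[of _ "[s]"])
  next
    case (eng g h)
    then obtain v w where "v \<in> lists S" "w \<in> lists S" "word_prod v = g" "word_prod w = h" by auto
    then show ?case using word_prod_append by (intro bexI[of _ "v @ w"]) auto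
  qed
  then show ?thesis using assms that coxeter by (auto simp: coxeter_system_def)
qed

text \<open>Induction by left multiplication with generators: claims about all of \<open>W\<close>
  reduce to one reflection at a time.\<close>

lemma carrier_induct [consumes 1, case_names one gen]:
  assumes "g \<in> carrier W" "P \<one>" "\<And>s h. s \<in> S \<Longrightarrow> h \<in> carrier W \<Longrightarrow> P h \<Longrightarrow> P (s \<otimes> h)"
  shows "P g"
proof -
  obtain w where w: "w \<in> lists S" "word_prod w = g" using obtain_word[OF assms(1)] .
  have "P (word_prod w)" using w(1) by (induction w) (auto intro: assms)
  then show ?thesis using w by simp
qed

lemma coxeter_exponents: "s \<in> S \<Longrightarrow> t \<in> S \<Longrightarrow> s \<noteq> t \<Longrightarrow> m s t = m t s"
  using coxeter by (auto simp: coxeter_system_def coxeter_matrix_def)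

end
section \<open>Representations of a Coxeter group\<close>

locale coxeter_rep = coxeter_group W S m + vector_space scale
  for W :: "('g, 'z) monoid_scheme" (structure) and S m
    and scale :: "complex \<Rightarrow> 'v::ab_group_add \<Rightarrow> 'v" +
  fixes V :: "'v set" and \<rho> :: "'g \<Rightarrow> 'v \<Rightarrow> 'v"
  assumes rep: "group_rep W scale V \<rho>"
begin

lemma subspace_V: "subspace V"
  using rep by (simp add: group_rep_def)

lemma act_closed: "g \<in> carrier W \<Longrightarrow> v \<in> V \<Longrightarrow> \<rho> g v \<in> V"
  and act_add: "g \<in> carrier W \<Longrightarrow> v \<in> V \<Longrightarrow> w \<in> V \<Longrightarrow> \<rho> g (v + w) = \<rho> g v + \<rho> g w"
  and act_scale: "g \<in> carrier W \<Longrightarrow> v \<in> V \<Longrightarrow> \<rho> g (scale c v) = scale c (\<rho> g v)"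
  and act_one: "v \<in> V \<Longrightarrow> \<rho> \<one> v = v"
  and act_mult: "g \<in> carrier W \<Longrightarrow> h \<in> carrier W \<Longrightarrow> v \<in> V \<Longrightarrow> \<rho> (g \<otimes> h) v = \<rho> g (\<rho> h v)"
  using rep by (simp_all add: group_rep_def)

lemma act_zero: "g \<in> carrier W \<Longrightarrow> \<rho> g 0 = 0"
  using act_scale[of g 0 0] subspace_0[OF subspace_V] by simp

lemma act_sum:
  assumes "g \<in> carrier W" "\<And>i. i \<in> I \<Longrightarrow> v i \<in> V"
  shows "\<rho> g (\<Sum>i\<in>I. v i) = (\<Sum>i\<in>I. \<rho> g (v i))"
  using assms(2)
  by (induction I rule: infinite_finite_induct)
    (simp_all add: act_zero act_add subspace_sum subspace_V assms(1))

lemma subrepI: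
  assumes "subspace U" "U \<subseteq> V" "\<And>s u. s \<in> S \<Longrightarrow> u \<in> U \<Longrightarrow> \<rho> s u \<in> U"
  shows "subrep W scale V \<rho> U"
proof -
  have "\<forall>u\<in>U. \<rho> g u \<in> U" if "g \<in> carrier W" for g
    using that assms(2,3) by (induction rule: carrier_induct) (auto simp: act_one act_mult subset_iff)
  then show ?thesis using assms(1,2) by (auto simp: subrep_def)
qed

lemma act_fixed:
  assumes "v \<in> V" "\<And>s. s \<in> S \<Longrightarrow> \<rho> s v = v" "g \<in> carrier W"
  shows "\<rho> g v = v"
  using assms(3,1,2) by (induction rule: carrier_induct) (auto simp: act_one act_mult)

lemma equivariant_generators:
  assumes "group_rep W scale' V' \<rho>'" "\<And>v. v \<in> V \<Longrightarrow> p v \<in> V'"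
    and "\<And>s v. s \<in> S \<Longrightarrow> v \<in> V \<Longrightarrow> p (\<rho> s v) = \<rho>' s (p v)"
    and "g \<in> carrier W" "v \<in> V"
  shows "p (\<rho> g v) = \<rho>' g (p v)"
proof -
  interpret R: coxeter_rep W S m scale' V' \<rho>'
    using assms(1) coxeter_group_axioms
    by (simp add: coxeter_rep_def coxeter_rep_axioms_def group_rep_def)
  show ?thesis using assms(4,5)
    by (induction arbitrary: v rule: carrier_induct)
      (auto simp: act_one act_mult R.act_one R.act_mult act_closed assms(2,3))
qed

end

text \<open>The first isomorphism theorem, for cosets encoded as sets.\<close>

lemma quot_rep_iso_if_surjective:
  assumes vs: "vector_space scale" and sub: "module.subspace scale V" and vs': "vector_space scale'"
    and act: "\<And>g v. g \<in> carrier W \<Longrightarrow> v \<in> V \<Longrightarrow> \<rho> g v \<in> V"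
    and add: "\<And>v w. v \<in> V \<Longrightarrow> w \<in> V \<Longrightarrow> p (v + w) = p v + p w"
    and smult: "\<And>c v. v \<in> V \<Longrightarrow> p (scale c v) = scale' c (p v)"
    and surj: "p ` V = V'"
    and N: "N = {v \<in> V. p v = 0}"
    and equi: "\<And>g v. g \<in> carrier W \<Longrightarrow> v \<in> V \<Longrightarrow> p (\<rho> g v) = \<rho>' g (p v)"
  shows "quot_rep_iso W scale V \<rho> N scale' V' \<rho>'"
proof -
  interpret vector_space scale by fact
  interpret V': vector_space scale' by fact
  \<comment> \<open>A coset is evaluated at an arbitrary representative. The fact \<open>f\<close>
    below shows that any member \<open>x\<close> of the set will do once all members differ from
    \<open>x\<close> by elements of \<open>N\<close>, where \<open>p\<close> vanishes.\<close>
  define f where "f X = p (SOME x. x \<in> X)" for X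
  have zero: "0 \<in> N" using sub smult[of 0 0] subspace_0 by (auto simp: N)
  have f: "f X = p x" if x: "x \<in> X" "x \<in> V" and all: "\<And>y. y \<in> X \<Longrightarrow> \<exists>n\<in>N. y = x + n" for X x
  proof -
    have "(SOME y. y \<in> X) \<in> X" using x(1) by (rule someI)
    then obtain n where "n \<in> N" "(SOME y. y \<in> X) = x + n" using all by blast
    then show ?thesis using x(2) add by (simp add: f_def N)
  qed
  have coset: "f (vcoset N v) = p v" if "v \<in> V" for v
    using zero that by (intro f) (auto simp: vcoset_def intro!: exI[of _ 0])
  have self: "v \<in> vcoset N v" for v using zero by (force simp: vcoset_def)
  have diff: "p (v - w) = p v - p w" if "v \<in> V" "w \<in> V" for v w
    using add[of v "scale (- 1) w"] smult[of w "- 1"] that sub by (simp add: subspace_neg)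
  have N_add: "n + n' \<in> N" if "n \<in> N" "n' \<in> N" for n n'
    using that sub add by (auto simp: N subspace_add)
  have N_scale: "scale c n \<in> N" if "n \<in> N" for c n
    using that sub smult by (auto simp: N subspace_scale)
  have bij: "bij_betw f (quot_space V N) V'"
  proof (rule bij_betw_imageI)
    show "inj_on f (quot_space V N)"
    proof (rule inj_onI)
      fix X Y assume "X \<in> quot_space V N" "Y \<in> quot_space V N" "f X = f Y"
      then obtain v w where vw: "v \<in> V" "w \<in> V" "X = vcoset N v" "Y = vcoset N w" "p v = p w"
        by (auto simp: quot_space_def coset)
      then have "v - w \<in> N" "w - v \<in> N" using sub diff by (auto simp: N subspace_diff)
      moreover have "vcoset N x \<subseteq> vcoset N y" if "x - y \<in> N" for x y
      proof
        fix z assume "z \<in> vcoset N x"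
        then obtain n where "n \<in> N" "z = y + (x - y + n)" by (auto simp: vcoset_def)
        then show "z \<in> vcoset N y" using N_add[OF that] unfolding vcoset_def by blast
      qed
      ultimately show "X = Y" unfolding vw(3,4) by blast
    qed
    show "f ` quot_space V N = V'" using surj coset by (auto simp: quot_space_def image_image)
  qed
  have 1: "f (quot_add X Y) = f X + f Y"
    if XY: "X \<in> quot_space V N" "Y \<in> quot_space V N" for X Y
  proof -
    obtain v w where vw: "v \<in> V" "w \<in> V" "X = vcoset N v" "Y = vcoset N w"
      using XY by (auto simp: quot_space_def)
    have "f (quot_add X Y) = p (v + w)"
    proof (rule f)
      show "v + w \<in> quot_add X Y"
        unfolding vw quot_add_def using self by blast
      show "v + w \<in> V" using vw sub by (simp add: subspace_add)
      fix y assume "y \<in> quot_add X Y"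
      then obtain n n' where "n \<in> N" "n' \<in> N" "y = v + n + (w + n')"
        unfolding vw quot_add_def vcoset_def by blast
      then show "\<exists>n\<in>N. y = v + w + n" using N_add by (intro bexI[of _ "n + n'"]) (auto simp: algebra_simps)
    qed
    then show ?thesis using vw coset add by simp
  qed
  have 2: "f (quot_scale scale N c X) = scale' c (f X)" if X: "X \<in> quot_space V N" for c X
  proof -
    obtain v where v: "v \<in> V" "X = vcoset N v" using X by (auto simp: quot_space_def)
    have "f (quot_scale scale N c X) = p (scale c v)"
    proof (rule f)
      show "scale c v \<in> quot_scale scale N c X"
        using self[of v] zero unfolding v quot_scale_def by force
      show "scale c v \<in> V" using v sub by (simp add: subspace_scale)
      fix y assume "y \<in> quot_scale scale N c X"
      then obtain n n' where "n \<in> N" "n' \<in> N" "y = scale c (v + n) + n'"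
        unfolding v quot_scale_def vcoset_def by blast
      then show "\<exists>n\<in>N. y = scale c v + n" using N_add N_scale
        by (intro bexI[of _ "scale c n + n'"]) (auto simp: scale_right_distrib)
    qed
    then show ?thesis using v coset smult by simp
  qed
  have 3: "f (quot_act \<rho> N g X) = \<rho>' g (f X)" if g: "g \<in> carrier W" and X: "X \<in> quot_space V N" for g X
  proof -
    obtain v where v: "v \<in> V" "X = vcoset N v" using X by (auto simp: quot_space_def)
    have "f (quot_act \<rho> N g X) = p (\<rho> g v)"
    proof (rule f)
      show "\<rho> g v \<in> quot_act \<rho> N g X"
        using self[of v] zero unfolding v quot_act_def by force
      show "\<rho> g v \<in> V" using v g act by simp
      fix y assume "y \<in> quot_act \<rho> N g X"
      then obtain n n' where n: "n \<in> N" "n' \<in> N" "y = \<rho> g (v + n) + n'"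
        unfolding v quot_act_def vcoset_def by blast
      have vn: "v + n \<in> V" using v n sub by (simp add: N subspace_add)
      have "y - \<rho> g v \<in> N"
        using n v g act vn sub diff add equi by (simp add: N subspace_add subspace_diff)
      then show "\<exists>n\<in>N. y = \<rho> g v + n" by (intro bexI[of _ "y - \<rho> g v"]) auto
    qed
    then show ?thesis using v g coset equi by simp
  qed
  show ?thesis unfolding quot_rep_iso_def by (intro exI[of _ f] conjI ballI allI bij 1 2 3)
qed
section \<open>IR-representations in coordinates\<close>

locale ir_representation = coxeter_group W S m + vector_space scale
  for W :: "('g, 'z) monoid_scheme" (structure) and S m
    and scale :: "complex \<Rightarrow> 'v::ab_group_add \<Rightarrow> 'v" +
  fixes V :: "'v set" and \<rho> :: "'g \<Rightarrow> 'v \<Rightarrow> 'v" and \<alpha> :: "'g \<Rightarrow> 'v"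
    and k :: "'g \<Rightarrow> 'g \<Rightarrow> nat" and a :: "'g \<Rightarrow> 'g \<Rightarrow> complex"
  assumes finite_S: "finite S" and finite_m: "\<And>r t. r \<in> S \<Longrightarrow> t \<in> S \<Longrightarrow> m r t \<noteq> 0"
    and datum: "ir_rep_of_datum W S m scale V \<rho> \<alpha> k a"

sublocale ir_representation \<subseteq> coxeter_rep
  using datum by unfold_locales (simp add: ir_rep_of_datum_def ir_rep_def)

text \<open>The angle is positive and at most pi/2, so its cosine vanishes only for
  \<open>2 * k = m\<close>, where the quotient is 2. If \<open>2 * k < m\<close>, a quotient of at
  most 2 would give \<open>m \<le> 2 * gcd m k \<le> 2 * k\<close>.\<close>

lemma cos_coeff_angle:
  fixes k m :: nat
  assumes "1 \<le> k" "real k \<le> real m / 2"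
  shows "0 \<le> cos (real k * pi / real m)" "cos (real k * pi / real m) < 1"
    and "cos (real k * pi / real m) \<noteq> 0 \<longleftrightarrow> m div gcd m k \<ge> 3"
proof -
  have m: "m > 0" "2 * k \<le> m" using assms by (simp_all add: field_simps)
  let ?x = "real k * pi / real m"
  have x: "0 < ?x" "?x \<le> pi / 2" using assms m by (auto simp: field_simps)
  show "0 \<le> cos ?x" using x pi_gt_zero by (intro cos_ge_zero) linarith+
  have "cos ?x < cos 0" using x pi_gt_zero by (intro cos_monotone_0_pi) linarith+
  then show "cos ?x < 1" by simp
  show "cos ?x \<noteq> 0 \<longleftrightarrow> m div gcd m k \<ge> 3"
  proof (cases "2 * k = m")
    case True
    then have "?x = pi / 2" "gcd m k = k" using m by (auto simp: field_simps)
    then show ?thesis using True m by (auto simp: cos_pi_half)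
  next
    case False
    then have lt: "2 * k < m" using m by simp
    then have "real k * 2 < real m" by linarith
    then have "?x < pi / 2" using m pi_gt_zero by (simp add: field_simps)
    then have "cos ?x > 0" using x pi_gt_zero by (intro cos_gt_zero_pi) linarith+
    have "gcd m k \<le> k" using assms by (intro gcd_le2_nat) auto
    obtain q where q: "m = gcd m k * q" using gcd_dvd1 by blast
    have "gcd m k > 0" using assms by auto
    then have "m div gcd m k = q" using q by (metis nonzero_mult_div_cancel_left less_irrefl)
    have "q \<ge> 3"
    proof (rule ccontr)
      assume "\<not> q \<ge> 3"
      then have "gcd m k * q \<le> k * 2" using \<open>gcd m k \<le> k\<close> by (intro mult_mono) auto
      then show False using q lt by simp
    qed
    then show ?thesis using \<open>cos ?x > 0\<close> \<open>m div gcd m k = q\<close> by simp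
  qed
qed

context ir_representation
begin

text \<open>These functions are the dual basis. As \<open>representation\<close> is 0 outside
  \<open>V\<close>, linearity is claimed only for members of \<open>V\<close>.\<close>

definition coord :: "'g \<Rightarrow> 'v \<Rightarrow> complex" where
  "coord t v = representation (\<alpha> ` S) v (\<alpha> t)"

abbreviation "A \<equiv> cos_matrix m k a"

definition form :: "'g \<Rightarrow> 'v \<Rightarrow> complex" where
  "form s v = (\<Sum>t\<in>S. A s t * coord t v)"

abbreviation "E \<equiv> ir_edges S m k"

lemma ir: "ir_rep W S scale V \<rho> \<alpha>"
  and ir_datum: "ir_datum S m k a"
  and act_root: "s \<in> S \<Longrightarrow> \<rho> s (\<alpha> s) = - \<alpha> s"
  and act_other: "s \<in> S \<Longrightarrow> t \<in> S \<Longrightarrow> s \<noteq> t \<Longrightarrow>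
    \<rho> s (\<alpha> t) = \<alpha> t + scale (2 * cos_coeff m k a s t) (\<alpha> s)"
  using datum by (simp_all add: ir_rep_of_datum_def)

lemma k_sym: "r \<in> S \<Longrightarrow> t \<in> S \<Longrightarrow> r \<noteq> t \<Longrightarrow> k r t = k t r"
  and k_ge: "r \<in> S \<Longrightarrow> t \<in> S \<Longrightarrow> r \<noteq> t \<Longrightarrow> 1 \<le> k r t"
  and k_le: "r \<in> S \<Longrightarrow> t \<in> S \<Longrightarrow> r \<noteq> t \<Longrightarrow> real (k r t) \<le> real (m r t) / 2"
  and a_nonzero: "r \<in> S \<Longrightarrow> t \<in> S \<Longrightarrow> r \<noteq> t \<Longrightarrow> a r t \<noteq> 0"
  using ir_datum unfolding ir_datum_def by blast+

lemma fam_independent: "fam_independent scale S \<alpha>" and span_roots: "span (\<alpha> ` S) = V"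
  using ir by (simp_all add: ir_rep_def fam_basis_def)

lemma inj_roots: "inj_on \<alpha> S" and independent_roots: "independent (\<alpha> ` S)"
  using fam_independent by (simp_all add: fam_independent_def)

lemma root_in [simp]: "s \<in> S \<Longrightarrow> \<alpha> s \<in> V"
  using span_roots span_base by blast

lemma coord_add: "v \<in> V \<Longrightarrow> w \<in> V \<Longrightarrow> coord t (v + w) = coord t v + coord t w"
  by (simp add: coord_def representation_add independent_roots span_roots)

lemma coord_scale: "v \<in> V \<Longrightarrow> coord t (scale c v) = c * coord t v"
  by (simp add: coord_def representation_scale independent_roots span_roots)

lemma coord_root: "s \<in> S \<Longrightarrow> t \<in> S \<Longrightarrow> coord t (\<alpha> s) = of_bool (t = s)"
  using inj_roots by (auto simp: coord_def representation_basis independent_roots dest: inj_onD)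

lemma coord_expansion: "v \<in> V \<Longrightarrow> v = (\<Sum>t\<in>S. scale (coord t v) (\<alpha> t))"
  using sum_representation_eq[of "\<alpha> ` S" v "\<alpha> ` S"]
  by (simp add: coord_def sum.reindex inj_roots independent_roots span_roots finite_S)

lemma coord_zero [simp]: "coord t 0 = 0"
  by (simp add: coord_def representation_zero)

lemma coord_sum: "(\<And>i. i \<in> I \<Longrightarrow> v i \<in> V) \<Longrightarrow> coord t (\<Sum>i\<in>I. v i) = (\<Sum>i\<in>I. coord t (v i))"
  by (simp add: coord_def representation_sum independent_roots span_roots)

lemma coord_combination:
  assumes "C \<subseteq> S" "t \<in> S"
  shows "coord t (\<Sum>s\<in>C. scale (c s) (\<alpha> s)) = (if t \<in> C then c t else 0)"
proof -
  have "coord t (\<Sum>s\<in>C. scale (c s) (\<alpha> s)) = (\<Sum>s\<in>C. coord t (scale (c s) (\<alpha> s)))"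
    using assms by (intro coord_sum subspace_scale subspace_V root_in) auto
  also have "\<dots> = (\<Sum>s\<in>C. if s = t then c s else 0)"
    using assms by (intro sum.cong refl) (auto simp: coord_scale coord_root subset_iff)
  also have "\<dots> = (if t \<in> C then c t else 0)"
    using finite_subset[OF assms(1) finite_S] by simp
  finally show ?thesis .
qed

lemma eq_zero_if_coord_zero: "v \<in> V \<Longrightarrow> (\<And>t. t \<in> S \<Longrightarrow> coord t v = 0) \<Longrightarrow> v = 0"
  using coord_expansion[of v] by simp

lemma form_add: "v \<in> V \<Longrightarrow> w \<in> V \<Longrightarrow> form s (v + w) = form s v + form s w"
  by (simp add: form_def coord_add algebra_simps sum.distrib)

lemma form_scale: "v \<in> V \<Longrightarrow> form s (scale c v) = c * form s v"
  by (simp add: form_def coord_scale sum_distrib_left mult_ac)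

lemma form_zero [simp]: "form s 0 = 0"
  by (simp add: form_def)

lemma form_root: "s \<in> S \<Longrightarrow> t \<in> S \<Longrightarrow> form s (\<alpha> t) = A s t"
  using finite_S by (simp add: form_def coord_root if_distrib of_bool_def cong: if_cong)

lemma A_diag [simp]: "A s s = 1"
  by (simp add: cos_matrix_def)

text \<open>The threshold 3 in the definition of the graph amounts to a nonzero cosine, so the edges
  are the off-diagonal support of \<open>A\<close>.\<close>

lemma A_nonzero_iff:
  assumes "s \<in> S" "t \<in> S" "s \<noteq> t"
  shows "A s t \<noteq> 0 \<longleftrightarrow> (s, t) \<in> E"
  using assms cos_coeff_angle(3)[OF k_ge k_le, OF assms assms] a_nonzero
  by (auto simp: cos_matrix_def cos_coeff_def ir_edges_def)

text \<open>The parameters \<open>a\<close> cancel in the product and leave the square of a cosine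
  that is nonnegative and less than 1. So the principal 2-by-2 minors of \<open>A\<close> are
  nonzero, which makes any two of the forms independent.\<close>

lemma A_swap_prod:
  assumes "s \<in> S" "t \<in> S" "s \<noteq> t"
  shows "A s t * A t s \<noteq> 1"
proof -
  let ?c = "cos (real (k s t) * pi / real (m s t))"
  have "A s t * A t s = of_real (?c * ?c)"
    using assms a_nonzero k_sym[OF assms] coxeter_exponents[OF assms]
    by (simp add: cos_matrix_def cos_coeff_def)
  moreover have "?c * ?c \<le> ?c * 1"
    using cos_coeff_angle(1,2)[OF k_ge k_le, OF assms assms] by (intro mult_left_mono) auto
  then have "?c * ?c < 1" using cos_coeff_angle(2)[OF k_ge k_le, OF assms assms] by simp
  ultimately show ?thesis by (metis of_real_eq_1_iff less_irrefl)
qed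

text \<open>On roots this is the datum, where the diagonal entry 1 of \<open>A\<close> produces the
  sign of \<open>\<rho> s (\<alpha> s)\<close>; the rest is linearity.\<close>

lemma act_eq:
  assumes "s \<in> S" "v \<in> V"
  shows "\<rho> s v = v - scale (2 * form s v) (\<alpha> s)"
proof -
  have root: "\<rho> s (\<alpha> t) = \<alpha> t - scale (2 * A s t) (\<alpha> s)" if "t \<in> S" for t
  proof (cases "s = t")
    case True
    have "scale 2 (\<alpha> t) = \<alpha> t + \<alpha> t"
      using scale_left_distrib[of 1 1 "\<alpha> t"] by simp
    then show ?thesis using True assms by (simp add: act_root)
  next
    case False
    then show ?thesis using assms that by (simp add: act_other cos_matrix_def)
  qed
  have "\<rho> s v = \<rho> s (\<Sum>t\<in>S. scale (coord t v) (\<alpha> t))"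
    using coord_expansion[OF assms(2)] by simp
  also have "\<dots> = (\<Sum>t\<in>S. scale (coord t v) (\<rho> s (\<alpha> t)))"
    using assms by (subst act_sum) (auto simp: act_scale subspace_scale subspace_V)
  also have "\<dots> = (\<Sum>t\<in>S. scale (coord t v) (\<alpha> t) - scale (2 * (A s t * coord t v)) (\<alpha> s))"
    using root by (intro sum.cong refl) (simp add: scale_right_diff_distrib mult_ac)
  also have "\<dots> = v - scale (2 * form s v) (\<alpha> s)"
    using coord_expansion[OF assms(2)]
    by (simp add: sum_subtractf form_def sum_distrib_left scale_sum_left)
  finally show ?thesis .
qed

lemma root_nonzero: "s \<in> S \<Longrightarrow> \<alpha> s \<noteq> 0"
  using coord_root[of s s] by auto

lemma act_eq_self_iff: "s \<in> S \<Longrightarrow> v \<in> V \<Longrightarrow> \<rho> s v = v \<longleftrightarrow> form s v = 0"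
  by (simp add: act_eq root_nonzero)

lemma edges_sym: "sym E"
  using k_sym coxeter_exponents by (auto simp: ir_edges_def sym_def)

lemma edges_subset: "E \<subseteq> S \<times> S"
  by (auto simp: ir_edges_def)

lemma in_span_subfamily_iff:
  assumes "C \<subseteq> S"
  shows "v \<in> span (\<alpha> ` C) \<longleftrightarrow> v \<in> V \<and> (\<forall>t\<in>S - C. coord t v = 0)"
proof
  assume "v \<in> span (\<alpha> ` C)"
  then obtain c where v: "v = (\<Sum>s\<in>C. scale (c s) (\<alpha> s))"
    unfolding in_span_family_iff[OF finite_subset[OF assms finite_S]] by blast
  moreover have "v \<in> V" unfolding v using assms
    by (intro subspace_sum subspace_scale subspace_V root_in) auto
  ultimately show "v \<in> V \<and> (\<forall>t\<in>S - C. coord t v = 0)"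
    using coord_combination[OF assms] by simp
next
  assume R: "v \<in> V \<and> (\<forall>t\<in>S - C. coord t v = 0)"
  have "v = (\<Sum>t\<in>S. scale (coord t v) (\<alpha> t))" using coord_expansion R by blast
  also have "\<dots> = (\<Sum>t\<in>C. scale (coord t v) (\<alpha> t))"
    using R assms finite_S by (intro sum.mono_neutral_right) auto
  finally show "v \<in> span (\<alpha> ` C)"
    unfolding in_span_family_iff[OF finite_subset[OF assms finite_S]] by (intro exI[of _ "\<lambda>t. coord t v"])
qed

section \<open>Fixed vectors and semisimplicity\<close>

text \<open>The vectors fixed by all generators, described as the kernel of \<open>A\<close> on
  coordinates. As \<open>A\<close> need not be symmetric, this is a one-sided radical.\<close>

definition radical :: "'v set" where
  "radical = {v \<in> V. \<forall>s\<in>S. form s v = 0}"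

abbreviation "components \<equiv> graph_components S E"

section \<open>Connected components and the block structure of \<open>A\<close>\<close>

lemma component_subset: "C \<in> components \<Longrightarrow> C \<subseteq> S"
  by (auto simp: graph_components_def)

lemma component_nonempty: "C \<in> components \<Longrightarrow> C \<noteq> {}"
  by (auto simp: graph_components_def)

lemma component_connected:
  assumes "C \<in> components" "s \<in> C" "t \<in> C"
  shows "(s, t) \<in> E\<^sup>*"
  using assms sym_rtrancl[OF edges_sym] by (auto simp: graph_components_def dest: symD intro: rtrancl_trans)

lemma component_closed:
  assumes "C \<in> components" "s \<in> C" "t \<in> S" "(s, t) \<in> E\<^sup>*"
  shows "t \<in> C"
  using assms by (auto simp: graph_components_def intro: rtrancl_trans)

lemma component_exists:
  assumes "s \<in> S"
  obtains C where "C \<in> components" "s \<in> C"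
  using assms by (auto simp: graph_components_def)

lemma component_unique:
  assumes "C \<in> components" "D \<in> components" "s \<in> C" "s \<in> D"
  shows "C = D"
  using assms component_connected component_closed component_subset by (meson subsetI subset_antisym subsetD)

text \<open>A nonzero entry is an edge, and an edge does not leave its component. So
  \<open>A\<close> is block diagonal along the components.\<close>

lemma A_eq_zero_if_separated:
  assumes "C \<in> components" "s \<in> S" "t \<in> S" "s \<in> C \<longleftrightarrow> t \<notin> C"
  shows "A s t = 0"
proof (rule ccontr)
  assume "A s t \<noteq> 0"
  then have "(s, t) \<in> E" using A_nonzero_iff assms by blast
  moreover from this have "(t, s) \<in> E" using edges_sym by (auto dest: symD)
  ultimately show False using component_closed[OF assms(1)] assms(2-4) by blast
qed

definition proj :: "'g set \<Rightarrow> 'v \<Rightarrow> 'v" where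
  "proj C v = (\<Sum>t\<in>C. scale (coord t v) (\<alpha> t))"

lemma proj_in: "C \<subseteq> S \<Longrightarrow> proj C v \<in> V"
  unfolding proj_def by (intro subspace_sum subspace_scale subspace_V root_in) auto

lemma proj_in_span: "C \<subseteq> S \<Longrightarrow> proj C v \<in> span (\<alpha> ` C)"
  unfolding proj_def by (intro span_sum span_scale span_base) auto

lemma coord_proj: "C \<subseteq> S \<Longrightarrow> t \<in> S \<Longrightarrow> coord t (proj C v) = (if t \<in> C then coord t v else 0)"
  unfolding proj_def by (simp add: coord_combination)

text \<open>Block diagonality makes the projections compatible with the forms. In particular, the
  projections of a fixed vector are fixed.\<close>

lemma form_proj:
  assumes "C \<in> components" "s \<in> S"
  shows "form s (proj C v) = (if s \<in> C then form s v else 0)"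
proof -
  have "form s (proj C v) = (\<Sum>t\<in>S. A s t * (if t \<in> C then coord t v else 0))"
    unfolding form_def using coord_proj component_subset[OF assms(1)] by (intro sum.cong) auto
  also have "\<dots> = (\<Sum>t\<in>S. if s \<in> C then A s t * coord t v else 0)"
    using A_eq_zero_if_separated[OF assms] by (intro sum.cong) auto
  also have "\<dots> = (if s \<in> C then form s v else 0)" by (simp add: form_def)
  finally show ?thesis .
qed

lemma sum_proj:
  assumes "v \<in> V"
  shows "v = (\<Sum>C\<in>components. proj C v)"
proof -
  have "finite C" if "C \<in> components" for C
    using component_subset[OF that] finite_S finite_subset by blast
  moreover have "\<forall>C\<in>components. \<forall>D\<in>components. C \<noteq> D \<longrightarrow> C \<inter> D = {}"
    using component_unique by blast
  ultimately have "(\<Sum>t\<in>\<Union>components. scale (coord t v) (\<alpha> t)) = (\<Sum>C\<in>components. proj C v)"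
    by (simp add: sum.Union_disjoint proj_def[abs_def] comp_def)
  moreover have "\<Union>components = S" using component_subset component_exists by blast
  ultimately show ?thesis using coord_expansion[OF assms] by simp
qed

section \<open>Fixed vectors and the dichotomy for sub-representations\<close>

lemma radical_subspace: "subspace radical"
  by (rule subspaceI)
    (auto simp: radical_def form_add form_scale subspace_add subspace_scale subspace_0 subspace_V)

lemma act_radical: "v \<in> radical \<Longrightarrow> g \<in> carrier W \<Longrightarrow> \<rho> g v = v"
  by (rule act_fixed) (auto simp: radical_def act_eq_self_iff)

lemma subrep_if_subset_radical:
  assumes "subspace U" "U \<subseteq> radical"
  shows "subrep W scale V \<rho> U"
  using assms by (intro subrepI) (auto simp: act_radical radical_def subset_iff)

text \<open>\<open>u - \<rho> s u\<close> is a nonzero multiple of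
  \<open>\<alpha> s\<close>.\<close>

lemma root_in_subrep:
  assumes "subspace U" "U \<subseteq> V" "\<And>u. u \<in> U \<Longrightarrow> \<rho> s u \<in> U" "s \<in> S" "u \<in> U" "form s u \<noteq> 0"
  shows "\<alpha> s \<in> U"
proof -
  have "scale (2 * form s u) (\<alpha> s) = u - \<rho> s u" using assms by (simp add: act_eq subset_iff)
  then have "scale (2 * form s u) (\<alpha> s) \<in> U" using assms by (simp add: subspace_diff)
  then have "scale (inverse (2 * form s u)) (scale (2 * form s u) (\<alpha> s)) \<in> U"
    by (rule subspace_scale[OF assms(1)])
  then show ?thesis using assms(6) by simp
qed

text \<open>For an edge between \<open>t\<close> and \<open>r\<close> the form of \<open>r\<close>
  is nonzero at \<open>\<alpha> t\<close>, so membership of roots spreads along paths.\<close>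

lemma component_in_subrep:
  assumes "C \<in> components" "s \<in> C" "\<alpha> s \<in> U"
    and U: "subspace U" "U \<subseteq> V" "\<And>s u. s \<in> S \<Longrightarrow> u \<in> U \<Longrightarrow> \<rho> s u \<in> U"
  shows "span (\<alpha> ` C) \<subseteq> U"
proof -
  have "\<alpha> t \<in> U" if "(s, t) \<in> E\<^sup>*" for t
    using that
  proof induction
    case base
    show ?case by fact
  next
    case (step t r)
    then have tr: "t \<in> S" "r \<in> S" "r \<noteq> t" "(r, t) \<in> E"
      using edges_subset edges_sym by (auto dest: symD simp: ir_edges_def)
    then have "form r (\<alpha> t) \<noteq> 0" using A_nonzero_iff by (simp add: form_root)
    then show ?case using root_in_subrep[OF U(1,2) U(3)] tr step.IH by blast
  qed
  then have "\<alpha> ` C \<subseteq> U" using component_connected[OF assms(1,2)] by blast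
  then show ?thesis using U(1) by (rule span_minimal)
qed

text \<open>A vector of \<open>U\<close> that is not killed by some \<open>form s\<close> puts
  \<open>\<alpha> s\<close> into \<open>U\<close>. Then \<open>s\<close> lies in \<open>C\<close>,
  as seen from coordinates, and the root spreads over the whole component.\<close>

lemma subrep_component_dichotomy:
  assumes C: "C \<in> components" and U: "subrep W scale (span (\<alpha> ` C)) \<rho> U"
  shows "U \<subseteq> radical \<or> U = span (\<alpha> ` C)"
proof (rule disjCI)
  assume "U \<noteq> span (\<alpha> ` C)"
  have U': "subspace U" "U \<subseteq> span (\<alpha> ` C)" "\<And>s u. s \<in> S \<Longrightarrow> u \<in> U \<Longrightarrow> \<rho> s u \<in> U"
    using U by (auto simp: subrep_def)
  have UV: "U \<subseteq> V" using U'(2) in_span_subfamily_iff[OF component_subset[OF C]] by blast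
  show "U \<subseteq> radical"
  proof
    fix u assume u: "u \<in> U"
    have "form s u = 0" if "s \<in> S" for s
    proof (rule ccontr)
      assume nz: "form s u \<noteq> 0"
      have \<alpha>: "\<alpha> s \<in> U" by (rule root_in_subrep[OF U'(1) UV U'(3)]) (use that u nz in auto)
      then have "\<forall>t\<in>S - C. coord t (\<alpha> s) = 0"
        using U'(2) in_span_subfamily_iff[OF component_subset[OF C]] by blast
      then have "s \<in> C" using coord_root[OF that that] that by force
      then have "span (\<alpha> ` C) \<subseteq> U" using component_in_subrep[OF C _ \<alpha> U'(1) UV U'(3)] by blast
      then show False using U'(2) \<open>U \<noteq> span (\<alpha> ` C)\<close> by blast
    qed
    then show "u \<in> radical" using u UV by (auto simp: radical_def)
  qed
qed

lemma root_not_radical: "s \<in> S \<Longrightarrow> \<alpha> s \<notin> radical"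
  using form_root[of s s] by (auto simp: radical_def intro!: bexI[of _ s])

lemma component_span_not_radical:
  assumes "C \<in> components"
  shows "\<not> span (\<alpha> ` C) \<subseteq> radical"
proof -
  obtain s where "s \<in> C" "s \<in> S"
    using component_nonempty[OF assms] component_subset[OF assms] by blast
  moreover from this have "\<alpha> s \<in> span (\<alpha> ` C)" by (intro span_base) simp
  ultimately show ?thesis using root_not_radical by blast
qed

text \<open>A reflection whose index lies outside \<open>C\<close> acts trivially on the span
  because \<open>A\<close> is block diagonal; one with index in \<open>C\<close> moves a vector by a
  multiple of a root of \<open>C\<close>.\<close>

lemma subrep_component:
  assumes "C \<in> components"
  shows "subrep W scale V \<rho> (span (\<alpha> ` C))"
proof (rule subrepI)
  have CS: "C \<subseteq> S" using component_subset[OF assms] .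
  show "span (\<alpha> ` C) \<subseteq> V" using in_span_subfamily_iff[OF CS] by blast
  fix s u assume s: "s \<in> S" and u: "u \<in> span (\<alpha> ` C)"
  then have "u \<in> V" using in_span_subfamily_iff[OF CS] by blast
  have "form s u = 0" if "s \<notin> C"
  proof -
    have "u = proj C u" using u in_span_subfamily_iff[OF CS] \<open>u \<in> V\<close> finite_S CS
      by (subst coord_expansion) (auto simp: proj_def intro: sum.mono_neutral_right)
    then show ?thesis using form_proj[OF assms s] that by metis
  qed
  then show "\<rho> s u \<in> span (\<alpha> ` C)"
    using s u \<open>u \<in> V\<close> by (cases "s \<in> C") (auto simp: act_eq intro!: span_diff span_scale intro: span_base)
qed simp

text \<open>The fixed vectors of the span form a proper subspace, as no root is fixed, and the
  dichotomy places every proper sub-representation inside it. A largest one is unique, as the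
  description by \<open>THE\<close> demands.\<close>

lemma max_proper_subrep_component:
  assumes C: "C \<in> components"
  shows "max_proper_subrep W scale (span (\<alpha> ` C)) \<rho> = radical \<inter> span (\<alpha> ` C)"
  unfolding max_proper_subrep_def
proof (rule the_equality)
  have "subrep W scale V \<rho> (radical \<inter> span (\<alpha> ` C))"
    by (intro subrep_if_subset_radical subspace_inter radical_subspace) auto
  then have 1: "subrep W scale (span (\<alpha> ` C)) \<rho> (radical \<inter> span (\<alpha> ` C))"
    by (simp add: subrep_def)
  have 2: "radical \<inter> span (\<alpha> ` C) \<noteq> span (\<alpha> ` C)" using component_span_not_radical[OF C] by blast
  have 3: "U \<subseteq> radical \<inter> span (\<alpha> ` C)"
    if "subrep W scale (span (\<alpha> ` C)) \<rho> U" "U \<noteq> span (\<alpha> ` C)" for U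
    using that subrep_component_dichotomy[OF C] by (auto simp: subrep_def)
  show "subrep W scale (span (\<alpha> ` C)) \<rho> (radical \<inter> span (\<alpha> ` C)) \<and>
      radical \<inter> span (\<alpha> ` C) \<noteq> span (\<alpha> ` C) \<and>
      (\<forall>U. subrep W scale (span (\<alpha> ` C)) \<rho> U \<and> U \<noteq> span (\<alpha> ` C) \<longrightarrow> U \<subseteq> radical \<inter> span (\<alpha> ` C))"
    using 1 2 3 by blast
  show "U = radical \<inter> span (\<alpha> ` C)"
    if "subrep W scale (span (\<alpha> ` C)) \<rho> U \<and> U \<noteq> span (\<alpha> ` C) \<and>
      (\<forall>U'. subrep W scale (span (\<alpha> ` C)) \<rho> U' \<and> U' \<noteq> span (\<alpha> ` C) \<longrightarrow> U' \<subseteq> U)" for U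
    using that 1 2 3 by blast
qed

lemma proj_radical:
  assumes "C \<in> components" "v \<in> radical"
  shows "proj C v \<in> radical"
  using assms proj_in[OF component_subset[OF assms(1)]] form_proj[OF assms(1)]
  by (auto simp: radical_def)

text \<open>A fixed vector is the sum of its projections to the components, and these are
  fixed.\<close>

lemma semisimple_kernel_eq: "semisimple_kernel W S m scale \<rho> \<alpha> k = radical"
proof -
  have eq: "semisimple_kernel W S m scale \<rho> \<alpha> k
      = span (\<Union>C\<in>components. radical \<inter> span (\<alpha> ` C))"
    unfolding semisimple_kernel_def using max_proper_subrep_component by simp
  show ?thesis unfolding eq
  proof
    show "span (\<Union>C\<in>components. radical \<inter> span (\<alpha> ` C)) \<subseteq> radical"
      by (rule span_minimal) (auto intro: radical_subspace)
    show "radical \<subseteq> span (\<Union>C\<in>components. radical \<inter> span (\<alpha> ` C))"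
    proof
      fix v assume v: "v \<in> radical"
      have "(\<Sum>C\<in>components. proj C v) \<in> span (\<Union>C\<in>components. radical \<inter> span (\<alpha> ` C))"
      proof (intro span_sum span_base)
        fix C assume "C \<in> components"
        then show "proj C v \<in> (\<Union>C\<in>components. radical \<inter> span (\<alpha> ` C))"
          using proj_radical[OF _ v] proj_in_span[OF component_subset] by blast
      qed
      moreover have "v = (\<Sum>C\<in>components. proj C v)" using v by (intro sum_proj) (simp add: radical_def)
      ultimately show "v \<in> span (\<Union>C\<in>components. radical \<inter> span (\<alpha> ` C))" by simp
    qed
  qed
qed

text \<open>The summands are the spans of the components. By the dichotomy a proper
  sub-representation of such a span lies in the radical, hence is zero.\<close>

lemma semisimple_if_radical_trivial:
  assumes "radical = {0}"
  shows "semisimple_rep W scale V \<rho>"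
  unfolding semisimple_rep_def
proof (intro exI[of _ "(\<lambda>C. span (\<alpha> ` C)) ` components"] conjI ballI)
  fix U assume "U \<in> (\<lambda>C. span (\<alpha> ` C)) ` components"
  then obtain C where C: "C \<in> components" and U: "U = span (\<alpha> ` C)" by blast
  have CS: "C \<subseteq> S" using component_subset[OF C] .
  show "subrep W scale V \<rho> U" unfolding U using C by (rule subrep_component)
  have "U' = {0} \<or> U' = U" if "subrep W scale U \<rho> U'" for U'
  proof -
    have "0 \<in> U'" using that subspace_0 by (auto simp: subrep_def)
    then show ?thesis using subrep_component_dichotomy[OF C] that assms unfolding U by blast
  qed
  moreover have "U \<noteq> {0}" using component_span_not_radical[OF C] assms U by blast
  ultimately show "irreducible_rep W scale U \<rho>" by (simp add: irreducible_rep_def)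
  \<comment> \<open>The other summands are supported on coordinates outside \<open>C\<close>, so a
    vector common to them and \<open>U\<close> has no nonzero coordinate.\<close>
  have "\<Union> ((\<lambda>C. span (\<alpha> ` C)) ` components - {U}) \<subseteq> span (\<alpha> ` (S - C))"
  proof
    fix v assume "v \<in> \<Union> ((\<lambda>C. span (\<alpha> ` C)) ` components - {U})"
    then obtain D where D: "D \<in> components" "v \<in> span (\<alpha> ` D)" "D \<noteq> C" using U by blast
    then have "D \<subseteq> S - C" using component_unique[OF D(1) C] component_subset[OF D(1)] by blast
    then show "v \<in> span (\<alpha> ` (S - C))" using D(2) span_mono[of "\<alpha> ` D"] by blast
  qed
  then have "span (\<Union> ((\<lambda>C. span (\<alpha> ` C)) ` components - {U})) \<subseteq> span (\<alpha> ` (S - C))"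
    by (rule span_minimal) simp
  moreover have "v = 0" if "v \<in> U" "v \<in> span (\<alpha> ` (S - C))" for v
    using that CS in_span_subfamily_iff[of C v] in_span_subfamily_iff[of "S - C" v]
    by (intro eq_zero_if_coord_zero) (auto simp: U)
  ultimately show "U \<inter> span (\<Union> ((\<lambda>C. span (\<alpha> ` C)) ` components - {U})) = {0}"
    using span_zero U by blast
next
  have "span (\<alpha> ` C) \<subseteq> V" if "C \<in> components" for C
    using subrep_component[OF that] by (simp add: subrep_def)
  then have "span (\<Union> ((\<lambda>C. span (\<alpha> ` C)) ` components)) \<subseteq> V"
    by (intro span_minimal subspace_V) blast
  moreover have "\<alpha> ` S \<subseteq> \<Union> ((\<lambda>C. span (\<alpha> ` C)) ` components)"
  proof
    fix x assume "x \<in> \<alpha> ` S"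
    then obtain s C where "x = \<alpha> s" "C \<in> components" "s \<in> C" using component_exists by blast
    moreover from this have "x \<in> span (\<alpha> ` C)" by (intro span_base) simp
    ultimately show "x \<in> \<Union> ((\<lambda>C. span (\<alpha> ` C)) ` components)" by blast
  qed
  then have "V \<subseteq> span (\<Union> ((\<lambda>C. span (\<alpha> ` C)) ` components))"
    unfolding span_roots[symmetric] by (rule span_mono)
  ultimately show "span (\<Union> ((\<lambda>C. span (\<alpha> ` C)) ` components)) = V" by blast
qed

text \<open>In a decomposition into irreducibles every root lies in one of the summands, since it
  lies in each summand on which its reflection acts nontrivially.  A component of a nonzero fixed
  vector would then span a proper sub-representation of such a summand.\<close>

lemma radical_trivial_if_semisimple:
  assumes "semisimple_rep W scale V \<rho>"
  shows "radical = {0}"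
proof (rule ccontr)
  obtain \<U> where irr: "\<And>U. U \<in> \<U> \<Longrightarrow> subrep W scale V \<rho> U \<and> irreducible_rep W scale U \<rho>"
    and span: "span (\<Union>\<U>) = V"
    using assms unfolding semisimple_rep_def by blast
  assume "radical \<noteq> {0}"
  then obtain v where v: "v \<in> radical" "v \<noteq> 0"
    using radical_subspace subspace_0 by blast
  have "\<exists>C\<in>components. proj C v \<noteq> 0"
    using v sum_proj[of v] by (metis (no_types, lifting) sum.neutral radical_def mem_Collect_eq)
  then obtain C where C: "C \<in> components" "proj C v \<noteq> 0" by blast
  then obtain s where s: "s \<in> C" "s \<in> S" using component_nonempty component_subset by blast
  \<comment> \<open>Otherwise \<open>form s\<close> would vanish on the span of all summands, hence
    at \<open>\<alpha> s\<close>, where its value is 1.\<close>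
  have "\<exists>U\<in>\<U>. \<exists>u\<in>U. form s u \<noteq> 0"
  proof (rule ccontr)
    assume "\<not> ?thesis"
    moreover have "U \<subseteq> V" if "U \<in> \<U>" for U using irr[OF that] by (simp add: subrep_def)
    ultimately have "\<Union>\<U> \<subseteq> {u \<in> V. form s u = 0}" by blast
    moreover have "subspace {u \<in> V. form s u = 0}"
      by (rule subspaceI)
        (auto simp: form_add form_scale subspace_add subspace_scale subspace_0 subspace_V)
    ultimately have "V \<subseteq> {u \<in> V. form s u = 0}" using span span_minimal by metis
    then show False using form_root[OF s(2) s(2)] root_in[OF s(2)] by auto
  qed
  then obtain U u where U: "U \<in> \<U>" "u \<in> U" "form s u \<noteq> 0" by blast
  have U': "subspace U" "U \<subseteq> V" "\<And>s u. s \<in> S \<Longrightarrow> u \<in> U \<Longrightarrow> \<rho> s u \<in> U"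
    using irr[OF U(1)] by (auto simp: subrep_def)
  have \<alpha>: "\<alpha> s \<in> U" by (rule root_in_subrep[OF U'(1,2) U'(3)]) (use s U in auto)
  then have "proj C v \<in> U"
    using component_in_subrep[OF C(1) s(1) \<alpha> U'] proj_in_span[OF component_subset[OF C(1)]] by blast
  then have sub: "span {proj C v} \<subseteq> U \<inter> radical"
    using U'(1) radical_subspace proj_radical[OF C(1) v(1)] by (intro span_minimal subspace_inter) auto
  have "subrep W scale U \<rho> (span {proj C v})"
    using subrep_if_subset_radical[of "span {proj C v}"] sub by (auto simp: subrep_def)
  moreover have "span {proj C v} \<noteq> {0}" using C(2) span_base[of "proj C v" "{proj C v}"] by auto
  ultimately have "U = span {proj C v}"
    using irr[OF U(1)] by (auto simp: irreducible_rep_def)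
  then show False using \<alpha> sub root_not_radical[OF s(2)] by blast
qed

text \<open>The linear relations among the columns of \<open>A\<close> are the coordinate vectors of
  members of the radical. Independence of the columns is invertibility of the transpose, which is
  then passed back to \<open>A\<close>.\<close>

lemma radical_trivial_iff_invertible: "radical = {0} \<longleftrightarrow> matrix_invertible_on S A"
proof -
  \<comment> \<open>Column \<open>t\<close> of \<open>A\<close>, written as a vector in the basis of
    roots.\<close>
  define b where "b t = (\<Sum>s\<in>S. scale (A s t) (\<alpha> s))" for t
  have b: "(\<Sum>t\<in>S. scale (c t) (b t)) = 0 \<longleftrightarrow> (\<forall>s\<in>S. form s (\<Sum>t\<in>S. scale (c t) (\<alpha> t)) = 0)" for c
  proof -
    have "(\<Sum>t\<in>S. scale (c t) (b t)) = (\<Sum>s\<in>S. scale (form s (\<Sum>t\<in>S. scale (c t) (\<alpha> t))) (\<alpha> s))"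
      unfolding b_def form_def
      by (simp add: coord_combination scale_sum_right scale_sum_left mult_ac) (rule sum.swap)
    then show ?thesis
      using fam_independent_iff[OF vector_space_axioms finite_S, THEN iffD1, OF fam_independent,
        rule_format, of "\<lambda>s. form s (\<Sum>t\<in>S. scale (c t) (\<alpha> t))"]
      by (auto intro!: sum.neutral)
  qed
  have "radical = {0} \<longleftrightarrow> fam_independent scale S b"
    unfolding fam_independent_iff[OF vector_space_axioms finite_S] b
  proof
    assume rad: "radical = {0}"
    show "\<forall>c. (\<forall>s\<in>S. form s (\<Sum>t\<in>S. scale (c t) (\<alpha> t)) = 0) \<longrightarrow> (\<forall>i\<in>S. c i = 0)"
    proof (intro allI impI)
      fix c assume "\<forall>s\<in>S. form s (\<Sum>t\<in>S. scale (c t) (\<alpha> t)) = 0"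
      moreover have "(\<Sum>t\<in>S. scale (c t) (\<alpha> t)) \<in> V"
        by (intro subspace_sum subspace_scale subspace_V root_in)
      ultimately have "(\<Sum>t\<in>S. scale (c t) (\<alpha> t)) = 0" using rad by (auto simp: radical_def)
      then show "\<forall>i\<in>S. c i = 0"
        using fam_independent fam_independent_iff[OF vector_space_axioms finite_S] by metis
    qed
  next
    assume R: "\<forall>c. (\<forall>s\<in>S. form s (\<Sum>t\<in>S. scale (c t) (\<alpha> t)) = 0) \<longrightarrow> (\<forall>i\<in>S. c i = 0)"
    have "v = 0" if "v \<in> radical" for v
      using that R[rule_format, of "\<lambda>t. coord t v"] coord_expansion[of v]
      by (intro eq_zero_if_coord_zero) (auto simp: radical_def)
    then show "radical = {0}" using subspace_0[OF radical_subspace] by blast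
  qed
  also have "\<dots> \<longleftrightarrow> matrix_invertible_on S (\<lambda>t s. A s t)"
    by (rule fam_independent_iff_matrix_invertible[OF vector_space_axioms finite_S fam_independent])
      (simp add: b_def)
  finally show ?thesis by (simp only: matrix_invertible_on_transpose[of S A])
qed

end
section \<open>The dual representation\<close>

lemma (in coxeter_rep) group_rep_subrep: "subrep W scale V \<rho> U \<Longrightarrow> group_rep W scale U \<rho>"
  using rep unfolding subrep_def group_rep_def by (simp add: subset_iff)

text \<open>With \<open>V\<close> the whole type, the linear functions on the type form the dual of
  \<open>V\<close>, and two functionals are equal when they are equal as functions.\<close>

locale full_ir_representation = ir_representation W S m scale UNIV \<rho> \<alpha> k a
  for W :: "('g, 'z) monoid_scheme" (structure) and S m
    and scale :: "complex \<Rightarrow> 'v::ab_group_add \<Rightarrow> 'v" and \<rho> \<alpha> k a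
begin

abbreviation "Vd \<equiv> dual_space scale"
abbreviation "\<rho>d \<equiv> dual_act W \<rho>"
abbreviation "dual_span \<equiv> fun_scale.span (form ` S)"

lemma dual_space_iff:
  "f \<in> Vd \<longleftrightarrow> (\<forall>v w. f (v + w) = f v + f w) \<and> (\<forall>c v. f (scale c v) = c * f v)"
proof -
  have "vector_space ((*) :: complex \<Rightarrow> complex \<Rightarrow> complex)"
    by unfold_locales (simp_all add: algebra_simps)
  then show ?thesis by (simp add: dual_space_def Vector_Spaces.linear_iff vector_space_axioms)
qed

text \<open>The inverse in \<open>dual_act\<close> makes this a left action: the order of a product
  is reversed twice.\<close>

lemma dual_rep: "group_rep W fun_scale Vd \<rho>d"
  unfolding group_rep_def
proof (intro conjI ballI allI)
  show "vector_space (fun_scale :: complex \<Rightarrow> ('v \<Rightarrow> complex) \<Rightarrow> _)" ..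
  show "fun_scale.subspace Vd"
    by (rule fun_scale.subspaceI) (auto simp: dual_space_iff algebra_simps)
  show "\<rho>d g f \<in> Vd" if "g \<in> carrier W" "f \<in> Vd" for g f
    using that by (simp add: dual_space_iff dual_act_def act_add act_scale)
  show "\<rho>d (g \<otimes> h) f = \<rho>d g (\<rho>d h f)" if "g \<in> carrier W" "h \<in> carrier W" for g h f
    using that by (simp add: dual_act_def inv_mult_group act_mult)
qed (simp_all add: dual_act_def fun_eq_iff act_one)

sublocale dual: coxeter_rep W S m fun_scale Vd \<rho>d
  using dual_rep by unfold_locales

lemma form_in_dual: "form s \<in> Vd" and coord_in_dual: "coord s \<in> Vd"
  by (simp_all add: dual_space_iff form_add form_scale coord_add coord_scale)

text \<open>Transposing the reflection formula exchanges the roles of the root and of the form; the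
  inverse in \<open>dual_act\<close> disappears because \<open>s\<close> is an involution.\<close>

lemma dual_act_eq: "s \<in> S \<Longrightarrow> f \<in> Vd \<Longrightarrow> \<rho>d s f = f - fun_scale (2 * f (\<alpha> s)) (form s)"
proof -
  assume s: "s \<in> S" and f: "f \<in> Vd"
  have "f (v - scale c w) = f v - c * f w" for v w c
    using f unfolding dual_space_iff
    by (metis add_uminus_conv_diff mult_minus_left scale_minus_left)
  then show ?thesis using s by (simp add: fun_eq_iff dual_act_def act_eq mult_ac)
qed

lemma form_root_self: "s \<in> S \<Longrightarrow> form s (\<alpha> s) = 1"
  by (simp add: form_root)

lemma form_nonzero: "s \<in> S \<Longrightarrow> form s \<noteq> 0"
  using form_root_self by (metis zero_fun_apply zero_neq_one)

lemma dual_act_form: "s \<in> S \<Longrightarrow> \<rho>d s (form s) = - form s"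
  by (simp add: dual_act_eq form_in_dual form_root_self fun_eq_iff)

text \<open>By the reflection formula \<open>\<rho>d s f = - f\<close> says that \<open>f\<close> is
  \<open>f (\<alpha> s)\<close> times \<open>form s\<close>.\<close>

lemma dual_eigenspace:
  assumes "s \<in> S"
  shows "{f \<in> Vd. \<rho>d s f = - f} = fun_scale.span {form s}"
proof
  show "{f \<in> Vd. \<rho>d s f = - f} \<subseteq> fun_scale.span {form s}"
  proof safe
    fix f assume f: "f \<in> Vd" "\<rho>d s f = - f"
    have "f v = f (\<alpha> s) * form s v" for v
      using fun_cong[OF f(2), of v] dual_act_eq[OF assms f(1)] by (simp add: field_simps)
    then have "f = fun_scale (f (\<alpha> s)) (form s)" unfolding fun_eq_iff fun_scale_apply by blast
    then show "f \<in> fun_scale.span {form s}"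
      by (metis fun_scale.span_base fun_scale.span_scale singletonI)
  qed
  show "fun_scale.span {form s} \<subseteq> {f \<in> Vd. \<rho>d s f = - f}"
    using assms
    by (auto simp: fun_scale.span_singleton dual.act_scale form_in_dual dual_act_form
        fun_scale.subspace_scale dual.subspace_V)
qed

lemma dual_sum: "f \<in> Vd \<Longrightarrow> f (\<Sum>i\<in>I. scale (c i) (v i)) = (\<Sum>i\<in>I. c i * f (v i))"
proof (induction I rule: infinite_finite_induct)
  case (insert x F)
  then show ?case by (simp add: dual_space_iff)
qed (metis dual_space_iff mult_zero_left scale_zero_left sum.infinite sum.empty)+

lemma dual_eq_on_roots: "f \<in> Vd \<Longrightarrow> f v = (\<Sum>t\<in>S. coord t v * f (\<alpha> t))"
  using dual_sum[of f "\<lambda>t. coord t v" \<alpha> S] coord_expansion[of v] by simp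

lemma dual_eqI: "f \<in> Vd \<Longrightarrow> g \<in> Vd \<Longrightarrow> (\<And>t. t \<in> S \<Longrightarrow> f (\<alpha> t) = g (\<alpha> t)) \<Longrightarrow> f = g"
  unfolding fun_eq_iff by (metis (no_types, lifting) dual_eq_on_roots sum.cong)

section \<open>The dual basis, independence of the forms and their reflections\<close>

lemma coord_independent: "fam_independent fun_scale S coord"
  unfolding fam_independent_iff[OF fun_scale.vector_space_axioms finite_S]
proof (intro allI impI ballI)
  fix c t assume "(\<Sum>i\<in>S. fun_scale (c i) (coord i)) = 0" and t: "t \<in> S"
  then have "(\<Sum>i\<in>S. fun_scale (c i) (coord i)) (\<alpha> t) = 0" by simp
  then have "(\<Sum>i\<in>S. if i = t then c i else 0) = 0"
    using t by (simp add: sum_fun_apply coord_root if_distrib of_bool_def cong: if_cong)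
  then show "c t = 0" using t finite_S by simp
qed

lemma span_coord: "fun_scale.span (coord ` S) = Vd"
proof
  show "fun_scale.span (coord ` S) \<subseteq> Vd"
    by (rule fun_scale.span_minimal) (auto simp: coord_in_dual dual.subspace_V)
  show "Vd \<subseteq> fun_scale.span (coord ` S)"
  proof
    fix f assume "f \<in> Vd"
    then have "f = (\<Sum>t\<in>S. fun_scale (f (\<alpha> t)) (coord t))"
      by (simp add: fun_eq_iff sum_fun_apply dual_eq_on_roots[of f] mult.commute)
    then show "f \<in> fun_scale.span (coord ` S)"
      unfolding fun_scale.in_span_family_iff[OF finite_S] by (intro exI[of _ "\<lambda>t. f (\<alpha> t)"])
  qed
qed

lemma form_eq_sum: "form s = (\<Sum>t\<in>S. fun_scale (A s t) (coord t))"
  by (simp add: fun_eq_iff sum_fun_apply form_def)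

lemma form_independent_iff: "fam_independent fun_scale S form \<longleftrightarrow> matrix_invertible_on S A"
  by (rule fam_independent_iff_matrix_invertible[OF fun_scale.vector_space_axioms finite_S
        coord_independent form_eq_sum])

lemma form_basis:
  assumes "fam_independent fun_scale S form"
  shows "fam_basis fun_scale Vd S form"
proof -
  have "form ` S \<subseteq> fun_scale.span (coord ` S)" by (auto simp: span_coord form_in_dual)
  then have "fun_scale.span (form ` S) = fun_scale.span (coord ` S)"
    by (rule fam_independent_span_eq[OF fun_scale.vector_space_axioms finite_S coord_independent assms])
  then show ?thesis using assms by (simp add: fam_basis_def span_coord)
qed

text \<open>Stated for any subspace of the dual that contains \<open>form s\<close>, because it
  serves both the whole dual and the span of the forms. The hyperplane consists of the functionals
  vanishing at \<open>\<alpha> s\<close>; it is complemented by \<open>form s\<close>, whose value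
  there is 1.\<close>

lemma dual_reflection:
  assumes "s \<in> S" "fun_scale.subspace U" "U \<subseteq> Vd" "form s \<in> U"
  shows "acts_as_reflection fun_scale U (\<rho>d s) (form s)"
proof -
  let ?H = "{f \<in> U. f (\<alpha> s) = 0}"
  have H: "fun_scale.subspace ?H"
    using assms(2) by (intro fun_scale.subspaceI)
      (auto simp: fun_scale.subspace_0 fun_scale.subspace_add fun_scale.subspace_scale)
  have "fun_scale.dim U = fun_scale.dim ?H + 1"
  proof (rule fun_scale.dim_eq_dim_hyperplane[OF H])
    show "finite (coord ` S)" using finite_S by simp
    show "?H \<subseteq> fun_scale.span (coord ` S)" using assms(3) by (auto simp: span_coord)
    show "form s \<notin> ?H" using form_root_self[OF assms(1)] by simp
    fix f
    show "f \<in> U \<longleftrightarrow> (\<exists>c. f - fun_scale c (form s) \<in> ?H)"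
    proof
      assume "f \<in> U"
      then show "\<exists>c. f - fun_scale c (form s) \<in> ?H"
        using assms form_root_self[OF assms(1)]
        by (intro exI[of _ "f (\<alpha> s)"])
          (auto simp: fun_scale.subspace_diff fun_scale.subspace_scale)
    next
      assume "\<exists>c. f - fun_scale c (form s) \<in> ?H"
      then obtain c where "f - fun_scale c (form s) \<in> U" by blast
      then have "(f - fun_scale c (form s)) + fun_scale c (form s) \<in> U"
        using assms by (intro fun_scale.subspace_add fun_scale.subspace_scale)
      then show "f \<in> U" by simp
    qed
  qed
  moreover have "\<rho>d s f = f" if "f \<in> ?H" for f
    using that assms by (auto simp: dual_act_eq fun_eq_iff)
  ultimately show ?thesis
    using H dual_act_form[OF assms(1)] by (auto simp: acts_as_reflection_def intro!: exI[of _ ?H])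
qed

text \<open>Evaluating a relation at both roots gives a 2-by-2 system with determinant
  \<open>1 - A r t * A t r\<close>, which is nonzero by \<open>A_swap_prod\<close>.\<close>

lemma form_pair_independent:
  assumes "r \<in> S" "t \<in> S" "r \<noteq> t"
  shows "fam_independent fun_scale {r, t} form"
proof -
  have "finite {r, t}" by simp
  show ?thesis unfolding fam_independent_iff[OF fun_scale.vector_space_axioms \<open>finite {r, t}\<close>]
  proof (intro allI impI)
    fix c assume "(\<Sum>i\<in>{r, t}. fun_scale (c i) (form i)) = 0"
    then have 0: "c r * form r v + c t * form t v = 0" for v
      using assms(3) by (simp add: fun_eq_iff)
    have 1: "c r = - c t * A t r" using 0[of "\<alpha> r"] assms by (simp add: form_root add_eq_0_iff)
    have "c r * A r t + c t = 0" using 0[of "\<alpha> t"] assms by (simp add: form_root)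
    then have "c t * (1 - A r t * A t r) = 0" unfolding 1 by (simp add: algebra_simps)
    then have "c t = 0" using A_swap_prod[OF assms] by simp
    then show "\<forall>i\<in>{r, t}. c i = 0" using 1 by simp
  qed
qed

text \<open>Each letter of a word changes a functional by a multiple of one form, and these changes
  accumulate inside the span. This yields both the invariance of the span and the trivial action
  modulo it.\<close>

lemma dual_act_diff_in: "g \<in> carrier W \<Longrightarrow> f \<in> Vd \<Longrightarrow> \<rho>d g f - f \<in> dual_span"
proof (induction rule: carrier_induct)
  case one
  then show ?case by (simp only: dual.act_one diff_self fun_scale.span_zero)
next
  case (gen s h)
  let ?f = "\<rho>d h f"
  have "?f \<in> Vd" using gen by (simp add: dual.act_closed)
  then have eq: "\<rho>d (s \<otimes> h) f - f = (?f - f) - fun_scale (2 * ?f (\<alpha> s)) (form s)"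
    using gen dual.act_mult[of s h f] dual_act_eq[of s ?f] by (simp add: gen_closed algebra_simps)
  show ?case unfolding eq
    by (intro fun_scale.span_diff[OF gen.IH[OF gen.prems]] fun_scale.span_scale fun_scale.span_base
        imageI gen.hyps)
qed

lemma dual_span_subset: "dual_span \<subseteq> Vd"
  by (rule fun_scale.span_minimal) (auto simp: form_in_dual dual.subspace_V)

lemma dual_span_subrep: "subrep W fun_scale Vd \<rho>d dual_span"
proof (rule dual.subrepI)
  fix s f assume "s \<in> S" "f \<in> dual_span"
  then have "(\<rho>d s f - f) + f \<in> dual_span"
    using dual_span_subset by (intro fun_scale.span_add dual_act_diff_in) auto
  then show "\<rho>d s f \<in> dual_span" by simp
qed (simp_all add: dual_span_subset)

lemma dual_span_r_rep: "r_rep W S m fun_scale dual_span \<rho>d form"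
  unfolding r_rep_def
proof (intro conjI ballI impI)
  show "group_rep W fun_scale dual_span \<rho>d"
    by (rule dual.group_rep_subrep[OF dual_span_subrep])
  fix s assume s: "s \<in> S"
  show "form s \<noteq> 0" using form_nonzero[OF s] .
  show "acts_as_reflection fun_scale dual_span (\<rho>d s) (form s)"
    using s dual_span_subset by (intro dual_reflection) (auto intro: fun_scale.span_base)
next
  fix r t assume "r \<in> S" "t \<in> S" "r \<noteq> t \<and> m r t \<noteq> 0"
  then show "fam_independent fun_scale {r, t} form" by (intro form_pair_independent) auto
qed simp

lemma dual_quotient_trivial:
  assumes "g \<in> carrier W" "X \<in> quot_space Vd dual_span"
  shows "quot_act \<rho>d dual_span g X = X"
proof -
  obtain f where f: "f \<in> Vd" and X: "X = vcoset dual_span f"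
    using assms(2) by (auto simp: quot_space_def)
  have mem: "x \<in> X \<longleftrightarrow> x - f \<in> dual_span" for x
  proof
    assume "x - f \<in> dual_span"
    then show "x \<in> X" unfolding X vcoset_def by (intro CollectI exI[of _ "x - f"]) simp
  qed (auto simp: X vcoset_def)
  have XV: "x \<in> Vd" if "x \<in> X" for x
  proof -
    have "f + (x - f) \<in> Vd"
      using mem that f dual_span_subset by (intro fun_scale.subspace_add dual.subspace_V) auto
    then show ?thesis by simp
  qed
  show ?thesis
  proof (rule equalityI; rule subsetI)
    fix y assume "y \<in> quot_act \<rho>d dual_span g X"
    then obtain x n where x: "x \<in> X" "n \<in> dual_span" "y = \<rho>d g x + n"
      unfolding quot_act_def by blast
    have "(\<rho>d g x - x) + (x - f) + n \<in> dual_span"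
      using x mem XV assms(1) by (intro fun_scale.span_add dual_act_diff_in) auto
    then show "y \<in> X" using x mem by (simp add: algebra_simps)
  next
    fix x assume x: "x \<in> X"
    have "- (\<rho>d g x - x) \<in> dual_span"
      using x XV assms(1) by (intro fun_scale.span_neg dual_act_diff_in) auto
    moreover have "x = \<rho>d g x + - (\<rho>d g x - x)" by simp
    ultimately show "x \<in> quot_act \<rho>d dual_span g X" using x unfolding quot_act_def by blast
  qed
qed

section \<open>The datum and the character of the dual\<close>

lemma dual_datum: "ir_datum S m k (\<lambda>r t. a t r)"
  using ir_datum by (auto simp: ir_datum_def)

lemma cos_coeff_swap:
  "s \<in> S \<Longrightarrow> t \<in> S \<Longrightarrow> s \<noteq> t \<Longrightarrow> cos_coeff m k (\<lambda>r t. a t r) s t = - A t s"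
  using k_sym[of s t] coxeter_exponents[of s t] by (simp add: cos_coeff_def cos_matrix_def)

text \<open>In the action of \<open>s\<close> on \<open>form t\<close> the coefficient of
  \<open>form s\<close> comes from \<open>form t (\<alpha> s) = A t s\<close>, with the indices in
  reverse order; this is why the parameters are transposed.\<close>

lemma dual_ir_rep_of_datum:
  assumes "fam_independent fun_scale S form"
  shows "ir_rep_of_datum W S m fun_scale Vd \<rho>d form k (\<lambda>r t. a t r)"
  unfolding ir_rep_of_datum_def ir_rep_def
proof (intro conjI ballI impI)
  fix s t assume "s \<in> S" "t \<in> S" "s \<noteq> t"
  then show "\<rho>d s (form t) = form t + fun_scale (2 * cos_coeff m k (\<lambda>r t. a t r) s t) (form s)"
    by (simp add: dual_act_eq form_in_dual form_root cos_coeff_swap fun_eq_iff)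
qed (simp_all add: dual_rep form_basis assms dual_datum dual_act_form dual_reflection
    dual.subspace_V form_in_dual)

end

text \<open>Transposing the parameters inverts the value on each edge, so the inverse of the
  homomorphism on chains restricts to the dual character.\<close>

lemma character_of_datum_dual:
  assumes "character_of_datum S m k a \<chi>"
  shows "character_of_datum S m k (\<lambda>r t. a t r) (dual_character \<chi>)"
proof -
  obtain \<phi> where "character_on (one_chains (ir_edges S m k)) \<phi>"
    "\<forall>(r, t)\<in>ir_edges S m k. \<phi> (edge_chain r t) = a t r / a r t"
    "\<forall>c\<in>H1 S (ir_edges S m k). \<chi> c = \<phi> c"
    using assms unfolding character_of_datum_def by blast
  then show ?thesis unfolding character_of_datum_def
    by (intro exI[of _ "\<lambda>c. inverse (\<phi> c)"]) (auto simp: character_on_def dual_character_def)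
qed
section \<open>Characters trivial on the cycles\<close>

lemma one_chainsD: "c \<in> one_chains E \<Longrightarrow> c (t, r) = - c (r, t)"
  and one_chains_outside: "c \<in> one_chains E \<Longrightarrow> e \<notin> E \<Longrightarrow> c e = 0"
  unfolding one_chains_def by blast+

lemma one_chainsI:
  "(\<And>r t. c (t, r) = - c (r, t)) \<Longrightarrow> (\<And>e. e \<notin> E \<Longrightarrow> c e = 0) \<Longrightarrow> c \<in> one_chains E"
  unfolding one_chains_def by blast

lemma one_chains_zero: "0 \<in> one_chains E"
  by (rule one_chainsI) simp_all

lemma one_chains_add: "c \<in> one_chains E \<Longrightarrow> d \<in> one_chains E \<Longrightarrow> c + d \<in> one_chains E"
proof (rule one_chainsI)
  show "(c + d) (t, r) = - (c + d) (r, t)" if "c \<in> one_chains E" "d \<in> one_chains E" for r t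
    using one_chainsD[OF that(1), of t r] one_chainsD[OF that(2), of t r] by simp
qed (simp add: one_chains_outside)

lemma one_chains_minus: "c \<in> one_chains E \<Longrightarrow> - c \<in> one_chains E"
proof (rule one_chainsI)
  show "(- c) (t, r) = - (- c) (r, t)" if "c \<in> one_chains E" for r t
    using one_chainsD[OF that, of t r] by simp
qed (simp add: one_chains_outside)

lemma character_on_one_chains:
  assumes "character_on (one_chains E) \<psi>"
  shows "\<psi> 0 = 1" and "c \<in> one_chains E \<Longrightarrow> \<psi> (- c) = inverse (\<psi> c)"
proof -
  have add: "\<psi> (c + d) = \<psi> c * \<psi> d" and nz: "\<psi> c \<noteq> 0"
    if "c \<in> one_chains E" "d \<in> one_chains E" for c d
    using assms that by (auto simp: character_on_def)
  show 1: "\<psi> 0 = 1"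
    using add[OF one_chains_zero one_chains_zero] nz[OF one_chains_zero one_chains_zero] by simp
  assume c: "c \<in> one_chains E"
  then have "- c \<in> one_chains E" by (rule one_chains_minus)
  then have "\<psi> c * \<psi> (- c) = 1" using add[OF c, of "- c"] 1 by simp
  then show "\<psi> (- c) = inverse (\<psi> c)" by (simp add: inverse_unique)
qed

lemma edge_chain_in:
  assumes "sym E" "(r, t) \<in> E"
  shows "edge_chain r t \<in> one_chains E"
proof -
  have "(t, r) \<in> E" using assms by (rule symD)
  show ?thesis
  proof (rule one_chainsI)
    show "edge_chain r t (y, x) = - edge_chain r t (x, y)" for x y
      by (simp add: edge_chain_def conj_commute)
    show "edge_chain r t e = 0" if "e \<notin> E" for e
    proof -
      have "e \<noteq> (r, t)" "e \<noteq> (t, r)" using that assms(2) \<open>(t, r) \<in> E\<close> by blast+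
      then show ?thesis by (simp add: edge_chain_def)
    qed
  qed
qed

lemma boundary_edge_chain:
  assumes "finite S" "r \<in> S" "t \<in> S"
  shows "(\<Sum>x\<in>S. edge_chain r t (x, v)) = of_bool (v = t) - of_bool (v = r)"
proof -
  have "(\<Sum>x\<in>S. edge_chain r t (x, v))
      = (\<Sum>x\<in>S. if x = r then of_bool (v = t) else 0) - (\<Sum>x\<in>S. if x = t then of_bool (v = r) else 0)"
    unfolding sum_subtractf[symmetric] by (intro sum.cong) (auto simp: edge_chain_def)
  then show ?thesis using assms by simp
qed

text \<open>Boundaries telescope when the edges of a path are added.\<close>

lemma path_chain:
  assumes "(r, t) \<in> E\<^sup>*" "finite S" "E \<subseteq> S \<times> S" "sym E"
  shows "\<exists>p\<in>one_chains E. \<forall>v. (\<Sum>x\<in>S. p (x, v)) = of_bool (v = t) - of_bool (v = r)"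
  using assms(1)
proof induction
  case base
  show ?case by (auto intro!: bexI[of _ 0] simp: one_chains_zero)
next
  case (step s t)
  then obtain p where p: "p \<in> one_chains E"
    "\<And>v. (\<Sum>x\<in>S. p (x, v)) = of_bool (v = s) - of_bool (v = r)" by blast
  show ?case
  proof (intro bexI[of _ "p + edge_chain s t"] allI)
    show "(\<Sum>x\<in>S. (p + edge_chain s t) (x, v)) = of_bool (v = t) - of_bool (v = r)" for v
      using p(2) boundary_edge_chain[OF assms(2), of s t] step.hyps assms(3)
      by (auto simp: sum.distrib)
    show "p + edge_chain s t \<in> one_chains E"
      using p(1) edge_chain_in[OF assms(4) step.hyps(2)] by (rule one_chains_add)
  qed
qed

text \<open>The potential at a vertex is the value of the character on a path to it from the base
  point of its component.\<close>

lemma character_potential: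
  assumes \<psi>: "character_on (one_chains E) \<psi>" and triv: "\<And>c. c \<in> H1 S E \<Longrightarrow> \<psi> c = 1"
    and E: "finite S" "E \<subseteq> S \<times> S" "sym E"
  shows "\<exists>d. (\<forall>t. d t \<noteq> 0) \<and> (\<forall>(s, t)\<in>E. d t = d s * \<psi> (edge_chain s t))"
proof -
  define base where "base t = (SOME r. (r, t) \<in> E\<^sup>*)" for t
  have "(base t, t) \<in> E\<^sup>*" for t unfolding base_def by (rule someI[of _ t]) simp
  then have "\<forall>t. \<exists>p\<in>one_chains E. \<forall>v. (\<Sum>x\<in>S. p (x, v)) = of_bool (v = t) - of_bool (v = base t)"
    using path_chain E by metis
  then obtain p where p: "\<And>t. p t \<in> one_chains E"
    "\<And>t v. (\<Sum>x\<in>S. p t (x, v)) = of_bool (v = t) - of_bool (v = base t)" by metis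
  have mult: "\<psi> (c + d) = \<psi> c * \<psi> d" and nz: "\<psi> c \<noteq> 0"
    if "c \<in> one_chains E" "d \<in> one_chains E" for c d
    using \<psi> that by (auto simp: character_on_def)
  have "\<psi> (p t) = \<psi> (p s) * \<psi> (edge_chain s t)" if st: "(s, t) \<in> E" for s t
  proof -
    \<comment> \<open>The chosen base point depends on a vertex only through the set of vertices
      connected to it, and this set is the same for both ends of an edge.\<close>
    have "(r, s) \<in> E\<^sup>* \<longleftrightarrow> (r, t) \<in> E\<^sup>*" for r
      using st E(3) by (meson r_into_rtrancl rtrancl_trans symD)
    then have base: "base s = base t" by (simp add: base_def)
    have chains: "p s + edge_chain s t \<in> one_chains E" "- p t \<in> one_chains E"
      "edge_chain s t \<in> one_chains E"
      using p(1) edge_chain_in[OF E(3) st] by (auto intro: one_chains_add one_chains_minus)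
    \<comment> \<open>Out to \<open>s\<close>, over the edge, and back from \<open>t\<close>: with a
      common base point this closes up to a cycle, on which the character is 1.\<close>
    have "(\<Sum>x\<in>S. (p s + edge_chain s t + - p t) (x, v)) = 0" for v
      using boundary_edge_chain[OF E(1), of s t v] st E(2) base
      by (auto simp: sum.distrib sum_subtractf p(2))
    then have "p s + edge_chain s t + - p t \<in> H1 S E"
      using one_chains_add[OF chains(1,2)] by (simp add: H1_def)
    then have "\<psi> (p s) * \<psi> (edge_chain s t) * inverse (\<psi> (p t)) = 1"
      using triv mult[OF chains(1,2)] mult[OF p(1) chains(3)] character_on_one_chains(2)[OF \<psi> p(1)]
      by metis
    then show ?thesis using nz[OF p(1) p(1)] by (simp add: field_simps)
  qed
  then show ?thesis using nz[OF p(1) p(1)] by (intro exI[of _ "\<lambda>t. \<psi> (p t)"]) auto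
qed

lemma dual_data_potential:
  assumes "character_of_datum S m k a \<chi>" "character_of_datum S m k b (dual_character \<chi>)"
    and E: "finite S" "sym (ir_edges S m k)"
  shows "\<exists>d. (\<forall>t. d t \<noteq> (0::complex)) \<and>
    (\<forall>(s, t)\<in>ir_edges S m k. d s = d t * ((a t s / a s t) * (b t s / b s t)))"
proof -
  let ?E = "ir_edges S m k"
  obtain \<phi> where \<phi>: "character_on (one_chains ?E) \<phi>"
    "\<And>r t. (r, t) \<in> ?E \<Longrightarrow> \<phi> (edge_chain r t) = a t r / a r t" "\<And>c. c \<in> H1 S ?E \<Longrightarrow> \<chi> c = \<phi> c"
    using assms(1) unfolding character_of_datum_def by fast
  obtain \<phi>' where \<phi>': "character_on (one_chains ?E) \<phi>'"
    "\<And>r t. (r, t) \<in> ?E \<Longrightarrow> \<phi>' (edge_chain r t) = b t r / b r t"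
    "\<And>c. c \<in> H1 S ?E \<Longrightarrow> dual_character \<chi> c = \<phi>' c"
    using assms(2) unfolding character_of_datum_def by fast
  have "\<exists>d. (\<forall>t. d t \<noteq> 0) \<and> (\<forall>(s, t)\<in>?E. d t = d s * (\<phi> (edge_chain s t) * \<phi>' (edge_chain s t)))"
  proof (rule character_potential[where \<psi> = "\<lambda>c. \<phi> c * \<phi>' c"])
    show "character_on (one_chains ?E) (\<lambda>c. \<phi> c * \<phi>' c)"
      using \<phi>(1) \<phi>'(1) by (auto simp: character_on_def)
    fix c assume c: "c \<in> H1 S ?E"
    then have "\<phi> c \<noteq> 0" using \<phi>(1) by (auto simp: character_on_def H1_def)
    then show "\<phi> c * \<phi>' c = 1"
      using c by (simp add: \<phi>(3)[symmetric] \<phi>'(3)[symmetric] dual_character_def)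
  qed (use E in \<open>auto simp: ir_edges_def\<close>)
  then obtain d where d: "\<And>t. d t \<noteq> 0"
    "\<And>s t. (s, t) \<in> ?E \<Longrightarrow> d t = d s * (\<phi> (edge_chain s t) * \<phi>' (edge_chain s t))" by blast
  \<comment> \<open>The potential is inverted to match the direction of the claim, which expresses
    \<open>d s\<close> by \<open>d t\<close> on an edge from \<open>s\<close> to
    \<open>t\<close>.\<close>
  have "inverse (d s) = inverse (d t) * ((a t s / a s t) * (b t s / b s t))" if "(s, t) \<in> ?E" for s t
  proof -
    have "d t = d s * ((a t s / a s t) * (b t s / b s t))"
      using d(2)[OF that] \<phi>(2)[OF that] \<phi>'(2)[OF that] by simp
    then show ?thesis using d(1)[of t] d(1)[of s] by (simp add: field_simps)
  qed
  then show ?thesis using d(1) by (intro exI[of _ "\<lambda>t. inverse (d t)"]) auto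
qed
section \<open>Intertwiners into the dual and the transposed representation\<close>

context full_ir_representation
begin

text \<open>The coordinate functions \<open>x\<close> are a parameter, so the source may be a
  representation on another type; \<open>d\<close> is the rescaling of the basis. The unscaled
  instance for the coordinates of \<open>V\<close> itself is \<open>to_dual\<close>.\<close>

definition intertwiner :: "('g \<Rightarrow> complex) \<Rightarrow> ('g \<Rightarrow> 'w \<Rightarrow> complex) \<Rightarrow> 'w \<Rightarrow> 'v \<Rightarrow> complex" where
  "intertwiner d x v = (\<Sum>t\<in>S. fun_scale (d t * x t v) (form t))"

lemma intertwiner_in: "intertwiner d x v \<in> dual_span"
  unfolding intertwiner_def
  by (intro fun_scale.span_sum fun_scale.span_scale fun_scale.span_base imageI)

lemma intertwiner_in_dual: "intertwiner d x v \<in> Vd"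
  by (rule subsetD[OF dual_span_subset intertwiner_in])

lemma intertwiner_basis:
  assumes "s \<in> S" "\<And>t. t \<in> S \<Longrightarrow> x t v = of_bool (t = s)"
  shows "intertwiner d x v = fun_scale (d s) (form s)"
  unfolding intertwiner_def
  using assms finite_S by (subst sum.mono_neutral_right[of S "{s}"]) (auto simp: fun_eq_iff)

lemma intertwiner_root: "r \<in> S \<Longrightarrow> intertwiner d x v (\<alpha> r) = (\<Sum>t\<in>S. d t * A t r * x t v)"
  by (simp add: intertwiner_def sum_fun_apply form_root mult_ac)

lemma dual_act_intertwiner:
  assumes "s \<in> S"
  shows "\<rho>d s (intertwiner d x v)
    = intertwiner d x v - fun_scale (2 * (\<Sum>t\<in>S. d t * A t s * x t v)) (form s)"
  using assms by (simp add: dual_act_eq intertwiner_in_dual intertwiner_root)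

section \<open>The representation of the transposed datum on the original space\<close>

definition form_t :: "'g \<Rightarrow> 'v \<Rightarrow> complex" where
  "form_t s v = (\<Sum>t\<in>S. A t s * coord t v)"

text \<open>The reflection given by the transpose of \<open>A\<close>, with the same roots. It
  provides a representation with the dual data even when \<open>A\<close> is singular and the forms
  are no basis of the dual.\<close>

definition refl_t :: "'g \<Rightarrow> 'v \<Rightarrow> 'v" where
  "refl_t s v = v - scale (2 * form_t s v) (\<alpha> s)"

abbreviation "to_dual \<equiv> intertwiner (\<lambda>_. 1) coord"

lemma form_t_add: "form_t s (v + w) = form_t s v + form_t s w"
  and form_t_scale: "form_t s (scale c v) = c * form_t s v"
  by (simp_all add: form_t_def coord_add coord_scale algebra_simps sum.distrib sum_distrib_left)

lemma form_t_diff: "form_t s (v - w) = form_t s v - form_t s w"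
  using form_t_add[of s v "scale (- 1) w"] form_t_scale[of s "- 1" w] by simp

lemma form_t_root: "s \<in> S \<Longrightarrow> t \<in> S \<Longrightarrow> form_t s (\<alpha> t) = A t s"
  using finite_S by (simp add: form_t_def coord_root if_distrib of_bool_def cong: if_cong)

lemma refl_t_add: "refl_t s (v + w) = refl_t s v + refl_t s w"
  by (simp add: refl_t_def form_t_add algebra_simps scale_left_distrib)

lemma refl_t_scale: "refl_t s (scale c v) = scale c (refl_t s v)"
  by (simp add: refl_t_def form_t_scale algebra_simps scale_right_diff_distrib)

lemma refl_t_involution: "s \<in> S \<Longrightarrow> refl_t s (refl_t s v) = v"
  by (simp add: refl_t_def form_t_diff form_t_scale form_t_root)

lemma to_dual_add: "to_dual (v + w) = to_dual v + to_dual w"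
  and to_dual_scale: "to_dual (scale c v) = fun_scale c (to_dual v)"
  by (simp_all add: intertwiner_def coord_add coord_scale fun_eq_iff sum_fun_apply
      algebra_simps sum.distrib sum_distrib_left)

lemma to_dual_diff: "to_dual (v - w) = to_dual v - to_dual w"
  using to_dual_add[of v "scale (- 1) w"] to_dual_scale[of "- 1" w] by (simp add: fun_eq_iff)

lemma to_dual_root: "s \<in> S \<Longrightarrow> to_dual (\<alpha> s) = form s"
  by (simp add: intertwiner_basis coord_root)

lemma to_dual_refl_t: "s \<in> S \<Longrightarrow> to_dual (refl_t s v) = \<rho>d s (to_dual v)"
  by (simp add: refl_t_def to_dual_diff to_dual_scale to_dual_root dual_act_intertwiner form_t_def)

text \<open>Stated for words, because the maps \<open>refl_t\<close> are not yet known to satisfy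
  the relations of \<open>W\<close>.\<close>

lemma to_dual_word: "w \<in> lists S \<Longrightarrow> to_dual (foldr refl_t w v) = \<rho>d (word_prod w) (to_dual v)"
proof (induction w)
  case Nil
  then show ?case by (simp add: dual.act_one intertwiner_in_dual)
next
  case (Cons s w)
  then show ?case by (auto simp: to_dual_refl_t dual.act_mult intertwiner_in_dual)
qed

lemma word_refl_t_diff_in:
  assumes "w \<in> lists {r, t}"
  shows "foldr refl_t w v - v \<in> span (\<alpha> ` {r, t})"
  using assms
proof (induction w)
  case Nil
  then show ?case by (simp add: span_zero)
next
  case (Cons s w)
  let ?u = "foldr refl_t w v"
  have "foldr refl_t (s # w) v - v = (?u - v) - scale (2 * form_t s ?u) (\<alpha> s)"
    by (simp add: refl_t_def algebra_simps)
  moreover have "?u - v \<in> span (\<alpha> ` {r, t})" "\<alpha> s \<in> span (\<alpha> ` {r, t})"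
    using Cons by (auto intro: span_base)
  ultimately show ?case using span_diff span_scale by metis
qed

text \<open>In general \<open>to_dual\<close> may have a kernel, but it carries two roots to two
  independent forms, hence is injective on their plane.\<close>

lemma to_dual_inj_on_pair:
  assumes "r \<in> S" "t \<in> S" "r \<noteq> t" "v \<in> span (\<alpha> ` {r, t})" "to_dual v = 0"
  shows "v = 0"
proof -
  have "finite {r, t}" by simp
  obtain c where v: "v = (\<Sum>i\<in>{r, t}. scale (c i) (\<alpha> i))"
    using assms(4) unfolding in_span_family_iff[OF \<open>finite {r, t}\<close>] by blast
  then have "(\<Sum>i\<in>{r, t}. fun_scale (c i) (form i)) = 0"
    using assms by (simp add: to_dual_add to_dual_scale to_dual_root)
  then have "\<forall>i\<in>{r, t}. c i = 0"
    using form_pair_independent[OF assms(1-3)]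
      fam_independent_iff[OF fun_scale.vector_space_axioms \<open>finite {r, t}\<close>] by metis
  then show ?thesis using assms(3) by (simp add: v)
qed

text \<open>A braid word moves vectors inside the plane of its two roots, on which \<open>to_dual\<close> is
  injective; so the braid relation is inherited from the dual representation.\<close>

lemma refl_t_braid:
  assumes "s \<in> S" "t \<in> S" "s \<noteq> t"
  shows "foldr refl_t (concat (replicate (m s t) [s, t])) v = v"
proof -
  let ?w = "concat (replicate (m s t) [s, t])"
  have w: "concat (replicate n [s, t]) \<in> lists {s, t}" for n by (induction n) auto
  then have "?w \<in> lists S" using assms lists_mono[of "{s, t}" S] by blast
  then have "to_dual (foldr refl_t ?w v) = \<rho>d (word_prod ?w) (to_dual v)"
    by (rule to_dual_word)
  also have "\<dots> = to_dual v"
    by (simp add: word_prod_braid[OF assms] dual.act_one intertwiner_in_dual)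
  finally have "to_dual (foldr refl_t ?w v - v) = 0" by (simp add: to_dual_diff)
  then have "foldr refl_t ?w v - v = 0"
    by (rule to_dual_inj_on_pair[OF assms word_refl_t_diff_in[OF w]])
  then show ?thesis by simp
qed

lemma refl_t_cox_eq: "cox_eq S m w w' \<Longrightarrow> foldr refl_t w v = foldr refl_t w' v"
proof (induction arbitrary: v rule: cox_eq.induct)
  case (cox_trans w w' w'')
  show ?case by (rule trans[OF cox_trans.IH])
next
  case (cox_sym w w')
  show ?case by (rule cox_sym.IH[symmetric])
next
  case (cox_square u w s)
  then show ?case by (simp add: refl_t_involution)
next
  case (cox_braid u w s t)
  show ?case
    unfolding foldr_append comp_apply refl_t_braid[OF cox_braid.hyps(3-5)] by (rule refl)
qed (rule refl)

lemma refl_t_rev: "w \<in> lists S \<Longrightarrow> foldr refl_t (rev w) (foldr refl_t w v) = v"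
  by (induction w) (auto simp: refl_t_involution)

text \<open>The presentation only speaks of words with product \<open>\<one>\<close>, so two words
  with equal products are compared through \<open>w\<close> followed by the reversal of
  \<open>w'\<close>.\<close>

lemma refl_t_word_prod_eq:
  assumes "w \<in> lists S" "w' \<in> lists S" "word_prod w = word_prod w'"
  shows "foldr refl_t w v = foldr refl_t w' v"
proof -
  have rev: "rev w' \<in> lists S" using assms(2) by (simp add: in_lists_conv_set)
  then have "word_prod (w @ rev w') = \<one>"
    using assms by (simp only: word_prod_append word_prod_rev r_inv word_prod_closed)
  then have "cox_eq S m (w @ rev w') []"
    using assms(1) rev by (subst word_prod_eq_one_iff[symmetric]) (auto simp del: foldr_append)
  then have "foldr refl_t w (foldr refl_t (rev w') (foldr refl_t w' v)) = foldr refl_t w' v"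
    using refl_t_cox_eq by fastforce
  then show ?thesis using refl_t_rev[OF assms(2)] by simp
qed

text \<open>An arbitrary word for \<open>g\<close> is chosen; \<open>refl_t_word_prod_eq\<close>
  makes the result independent of the choice.\<close>

definition act_t :: "'g \<Rightarrow> 'v \<Rightarrow> 'v" where
  "act_t g = foldr refl_t (SOME w. w \<in> lists S \<and> word_prod w = g)"

lemma act_t_word:
  assumes "w \<in> lists S"
  shows "act_t (word_prod w) v = foldr refl_t w v"
proof -
  have "\<exists>w'. w' \<in> lists S \<and> word_prod w' = word_prod w" using assms by blast
  from someI_ex[OF this] show ?thesis
    unfolding act_t_def by (intro refl_t_word_prod_eq assms) blast+
qed

lemma act_t_gen: "s \<in> S \<Longrightarrow> act_t s v = refl_t s v"
  using act_t_word[of "[s]"] by simp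

lemma group_rep_act_t: "group_rep W scale UNIV act_t"
  unfolding group_rep_def
proof (intro conjI ballI allI)
  fix g assume g: "g \<in> carrier W"
  obtain w where w: "w \<in> lists S" "word_prod w = g" using obtain_word[OF g] .
  show "act_t g (v + u) = act_t g v + act_t g u" for v u
    unfolding w(2)[symmetric] act_t_word[OF w(1)] by (induction w) (simp_all add: refl_t_add)
  show "act_t g (scale c v) = scale c (act_t g v)" for c v
    unfolding w(2)[symmetric] act_t_word[OF w(1)] by (induction w) (simp_all add: refl_t_scale)
  fix h v assume h: "h \<in> carrier W"
  obtain w' where w': "w' \<in> lists S" "word_prod w' = h" using obtain_word[OF h] .
  have "act_t (word_prod w \<otimes> word_prod w') v = act_t (word_prod (w @ w')) v"
    by (simp only: word_prod_append w(1) w'(1))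
  also have "\<dots> = foldr refl_t (w @ w') v" using w(1) w'(1) by (intro act_t_word) simp
  also have "\<dots> = act_t (word_prod w) (act_t (word_prod w') v)"
    by (simp only: act_t_word w(1) w'(1) foldr_append comp_apply)
  finally show "act_t (g \<otimes> h) v = act_t g (act_t h v)" by (simp only: w(2) w'(2))
next
  show "act_t \<one> v = v" for v using act_t_word[of "[]" v] by simp
qed (simp_all add: vector_space_axioms)

lemma reflection_act_t:
  assumes "s \<in> S"
  shows "acts_as_reflection scale UNIV (act_t s) (\<alpha> s)"
proof -
  let ?H = "{v. form_t s v = 0}"
  have root: "form_t s (\<alpha> s) = 1" using assms by (simp add: form_t_root)
  have H: "subspace ?H"
    using form_t_scale[of s 0 0] by (intro subspaceI) (simp_all add: form_t_add form_t_scale)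
  have "dim UNIV = dim ?H + 1"
  proof (rule dim_eq_dim_hyperplane[OF H])
    show "finite (\<alpha> ` S)" using finite_S by simp
    show "?H \<subseteq> span (\<alpha> ` S)" by (simp add: span_roots)
    show "\<alpha> s \<notin> ?H" using root by simp
    show "v \<in> UNIV \<longleftrightarrow> (\<exists>c. v - scale c (\<alpha> s) \<in> ?H)" for v
      using root by (auto simp: form_t_diff form_t_scale)
  qed
  moreover have "act_t s v = v" if "v \<in> ?H" for v
    using that assms by (simp add: act_t_gen refl_t_def)
  moreover have "act_t s (\<alpha> s) = - \<alpha> s"
    using assms root scale_left_distrib[of 1 1 "\<alpha> s"] by (simp add: act_t_gen refl_t_def)
  ultimately show ?thesis using H by (auto simp: acts_as_reflection_def intro!: exI[of _ ?H])
qed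

lemma ir_rep_of_datum_act_t: "ir_rep_of_datum W S m scale UNIV act_t \<alpha> k (\<lambda>r t. a t r)"
  unfolding ir_rep_of_datum_def ir_rep_def
proof (intro conjI ballI impI)
  show "fam_basis scale UNIV S \<alpha>" using ir by (simp add: ir_rep_def)
  fix r t assume "r \<in> S" "t \<in> S" "r \<noteq> t"
  then show "act_t r (\<alpha> t) = \<alpha> t + scale (2 * cos_coeff m k (\<lambda>r t. a t r) r t) (\<alpha> r)"
    by (simp add: act_t_gen refl_t_def form_t_root cos_coeff_swap)
qed (use reflection_act_t in \<open>simp_all add: group_rep_act_t dual_datum acts_as_reflection_def\<close>)

text \<open>The parameters \<open>b\<close> of the source and the transposed \<open>a\<close> share
  only their character on cycles; the potential absorbs the difference between them.\<close>

lemma quot_rep_iso_dual_span: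
  fixes scale' :: "complex \<Rightarrow> 'w::ab_group_add \<Rightarrow> 'w"
  assumes \<chi>: "character_of_datum S m k a \<chi>"
    and data: "ir_rep_of_data W S m scale' V' \<rho>' \<alpha>' k (dual_character \<chi>)"
  shows "quot_rep_iso W scale' V' \<rho>' (semisimple_kernel W S m scale' \<rho>' \<alpha>' k) fun_scale dual_span \<rho>d"
proof -
  obtain b where datum': "ir_rep_of_datum W S m scale' V' \<rho>' \<alpha>' k b"
    and b: "character_of_datum S m k b (dual_character \<chi>)"
    using data unfolding ir_rep_of_data_def by blast
  have vs': "vector_space scale'"
    using datum' by (simp add: ir_rep_of_datum_def ir_rep_def group_rep_def)
  have "ir_representation W S m scale' V' \<rho>' \<alpha>' k b"
    by (rule ir_representation.intro[OF coxeter_group_axioms vs'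
        ir_representation_axioms.intro[OF finite_S finite_m datum']])
  then interpret R: ir_representation W S m scale' V' \<rho>' \<alpha>' k b .
  obtain d where "(\<forall>t. d t \<noteq> (0::complex)) \<and>
      (\<forall>(s, t)\<in>E. d s = d t * ((a t s / a s t) * (b t s / b s t)))"
    using dual_data_potential[OF \<chi> b finite_S edges_sym] by (rule exE)
  then have d: "\<And>t. d t \<noteq> 0"
    and d_edge: "\<And>s t. (s, t) \<in> E \<Longrightarrow> d s = d t * ((a t s / a s t) * (b t s / b s t))"
    by blast+
  \<comment> \<open>The transpose of the matrix of \<open>a\<close> and the matrix of
    \<open>b\<close> are conjugate by the diagonal matrix of \<open>d\<close>: both are 1 on the
    diagonal and vanish off the edges, and on an edge the potential relates them.\<close>
  have transport: "d t * A t s = d s * R.A s t" if "s \<in> S" "t \<in> S" for s t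
  proof (cases "s = t \<or> (s, t) \<notin> E")
    case True
    moreover have "(s, t) \<in> E \<longleftrightarrow> (t, s) \<in> E" using edges_sym by (meson symD)
    ultimately show ?thesis
      using that A_nonzero_iff[of t s] R.A_nonzero_iff[of s t] by (cases "s = t") auto
  next
    case False
    then have st: "s \<noteq> t" "(s, t) \<in> E" by auto
    have "d t * (a t s / a s t) = d s * (b s t / b t s)"
      using d_edge[OF st(2)] that st a_nonzero R.a_nonzero by (simp add: field_simps)
    moreover have "d t * A t s
        = - (d t * (a t s / a s t) * of_real (cos (real (k s t) * pi / real (m s t))))"
      using st k_sym[OF that st(1)] coxeter_exponents[OF that st(1)]
      by (simp add: cos_matrix_def cos_coeff_def)
    moreover have "d s * R.A s t
        = - (d s * (b s t / b t s) * of_real (cos (real (k s t) * pi / real (m s t))))"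
      using st by (simp add: cos_matrix_def cos_coeff_def)
    ultimately show ?thesis by (simp only:)
  qed
  let ?p = "intertwiner d R.coord"
  \<comment> \<open>The left side is the value at \<open>\<alpha> s\<close> of the image of
    \<open>v\<close>, so this value is \<open>d s\<close> times the form of the source. Equivariance
    and the kernel both follow from it.\<close>
  have form_R: "(\<Sum>t\<in>S. d t * A t s * R.coord t v) = d s * R.form s v" if "s \<in> S" for s v
    unfolding R.form_def sum_distrib_left
    using transport that by (intro sum.cong) (simp_all add: mult.assoc[symmetric])
  have add: "?p (v + w) = ?p v + ?p w" if "v \<in> V'" "w \<in> V'" for v w
    using that by (simp add: intertwiner_def R.coord_add fun_eq_iff sum_fun_apply algebra_simps sum.distrib)
  have smult: "?p (scale' c v) = fun_scale c (?p v)" if "v \<in> V'" for c v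
    using that by (simp add: intertwiner_def R.coord_scale fun_eq_iff sum_fun_apply sum_distrib_left mult_ac)
  have root: "?p (\<alpha>' s) = fun_scale (d s) (form s)" if "s \<in> S" for s
    using that by (simp add: intertwiner_basis R.coord_root)
  have gen: "?p (\<rho>' s v) = \<rho>d s (?p v)" if "s \<in> S" "v \<in> V'" for s v
  proof -
    have "?p (v + scale' (- 2 * R.form s v) (\<alpha>' s)) = ?p v + fun_scale (- 2 * R.form s v) (?p (\<alpha>' s))"
      using that by (simp only: add smult R.subspace_scale[OF R.subspace_V] R.root_in)
    moreover have "\<rho>d s (?p v) = ?p v - fun_scale (2 * (d s * R.form s v)) (form s)"
      using that by (simp only: dual_act_intertwiner form_R)
    ultimately show ?thesis using that by (simp add: R.act_eq root fun_eq_iff mult_ac)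
  qed
  have equi: "?p (\<rho>' g v) = \<rho>d g (?p v)" if "g \<in> carrier W" "v \<in> V'" for g v
    by (rule R.equivariant_generators[OF dual_rep _ gen that]) (rule intertwiner_in_dual)+
  have surj: "?p ` V' = dual_span"
  proof
    show "?p ` V' \<subseteq> dual_span" by (intro image_subsetI intertwiner_in)
    show "dual_span \<subseteq> ?p ` V'"
    proof (rule fun_scale.span_minimal)
      show "form ` S \<subseteq> ?p ` V'"
      proof safe
        fix s assume s: "s \<in> S"
        \<comment> \<open>Nonvanishing of the potential enters here: \<open>form s\<close> is the
          image of \<open>\<alpha>' s\<close> divided by \<open>d s\<close>.\<close>
        have "?p (scale' (inverse (d s)) (\<alpha>' s)) = form s"
          using s d[of s] by (simp add: smult root fun_eq_iff)
        then show "form s \<in> ?p ` V'"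
          using s R.subspace_scale[OF R.subspace_V R.root_in] by (metis imageI)
      qed
      show "fun_scale.subspace (?p ` V')"
      proof (rule fun_scale.subspaceI)
        show "0 \<in> ?p ` V'"
          using smult[of 0 0] R.subspace_0[OF R.subspace_V] by (intro image_eqI[of _ _ 0]) (auto simp: fun_eq_iff)
      next
        fix f g assume "f \<in> ?p ` V'" "g \<in> ?p ` V'"
        then obtain v w where "v \<in> V'" "w \<in> V'" "f = ?p v" "g = ?p w" by blast
        then show "f + g \<in> ?p ` V'"
          using add[of v w] R.subspace_add[OF R.subspace_V] by (intro image_eqI[of _ _ "v + w"]) auto
      next
        fix c f assume "f \<in> ?p ` V'"
        then obtain v where "v \<in> V'" "f = ?p v" by blast
        then show "fun_scale c f \<in> ?p ` V'"
          using smult[of v c] R.subspace_scale[OF R.subspace_V] by (intro image_eqI[of _ _ "scale' c v"]) auto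
      qed
    qed
  qed
  \<comment> \<open>A functional is zero once it vanishes at the roots, and there its values are
    \<open>d s\<close> times the forms of the source, with \<open>d s\<close> nonzero.\<close>
  have "R.radical = {v \<in> V'. ?p v = 0}"
  proof -
    have "?p v = 0 \<longleftrightarrow> (\<forall>s\<in>S. ?p v (\<alpha> s) = 0)" for v
    proof
      assume "\<forall>s\<in>S. ?p v (\<alpha> s) = 0"
      then show "?p v = 0"
        using intertwiner_in_dual fun_scale.subspace_0[OF dual.subspace_V] by (intro dual_eqI) auto
    qed simp
    then show ?thesis using d by (simp add: R.radical_def intertwiner_root form_R cong: ball_cong)
  qed
  then show ?thesis unfolding R.semisimple_kernel_eq
    by (intro quot_rep_iso_if_surjective[where p = ?p] vs' fun_scale.vector_space_axioms R.subspace_V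
        R.act_closed add smult surj equi)
qed

end

section \<open>Transfer to the vectors of the statement\<close>

lemma fam_independent_cong:
  "(\<And>s. s \<in> I \<Longrightarrow> x s = y s) \<Longrightarrow> fam_independent scale I x \<longleftrightarrow> fam_independent scale I y"
  unfolding fam_independent_def by (simp cong: inj_on_cong image_cong)

text \<open>The vectors \<open>\<gamma> s\<close> and \<open>form s\<close> are compared on
  \<open>S\<close> only, so results about the forms are carried over by congruence.\<close>

lemma r_rep_cong:
  assumes "\<And>s. s \<in> S \<Longrightarrow> x s = y s"
  shows "r_rep W S m scale V \<rho> x \<longleftrightarrow> r_rep W S m scale V \<rho> y"
proof -
  have "x ` S = y ` S" using assms by (rule image_cong[OF refl])
  moreover have "fam_independent scale {r, t} x \<longleftrightarrow> fam_independent scale {r, t} y"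
    if "r \<in> S" "t \<in> S" for r t
    using assms that by (intro fam_independent_cong) auto
  ultimately show ?thesis using assms unfolding r_rep_def by (simp cong: ball_cong)
qed

lemma ir_rep_of_datum_cong:
  assumes "\<And>s. s \<in> S \<Longrightarrow> x s = y s"
  shows "ir_rep_of_datum W S m scale V \<rho> x k a \<longleftrightarrow> ir_rep_of_datum W S m scale V \<rho> y k a"
proof -
  have "x ` S = y ` S" using assms by (rule image_cong[OF refl])
  moreover have "fam_independent scale S x \<longleftrightarrow> fam_independent scale S y"
    using assms by (rule fam_independent_cong)
  ultimately show ?thesis
    using assms unfolding ir_rep_of_datum_def ir_rep_def fam_basis_def by (simp cong: ball_cong)
qed

theorem proposition6p8:
  fixes W :: "('g, 'z) monoid_scheme" and S :: "'g set" and m :: "'g \<Rightarrow> 'g \<Rightarrow> nat"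
    and scale :: "complex \<Rightarrow> 'v::ab_group_add \<Rightarrow> 'v"
    and \<rho> :: "'g \<Rightarrow> 'v \<Rightarrow> 'v" and \<alpha> :: "'g \<Rightarrow> 'v"
    and k :: "'g \<Rightarrow> 'g \<Rightarrow> nat" and a :: "'g \<Rightarrow> 'g \<Rightarrow> complex"
    and \<chi> :: "('g \<times> 'g \<Rightarrow> int) \<Rightarrow> complex"
    and \<alpha>d \<gamma> :: "'g \<Rightarrow> 'v \<Rightarrow> complex"
    and Vd V1 :: "('v \<Rightarrow> complex) set"
    and \<rho>d :: "'g \<Rightarrow> ('v \<Rightarrow> complex) \<Rightarrow> 'v \<Rightarrow> complex"
    and A :: "'g \<Rightarrow> 'g \<Rightarrow> complex"
  assumes coxeter: "coxeter_system W S m" and finite_rank: "finite S"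
    and finite_m: "\<forall>r\<in>S. \<forall>t\<in>S. m r t \<noteq> 0"
    and V: "ir_rep_of_datum W S m scale UNIV \<rho> \<alpha> k a"
    and \<chi>: "character_of_datum S m k a \<chi>"
    and Vd_eq: "Vd = dual_space scale"
    and \<rho>d_eq: "\<rho>d = dual_act W \<rho>"
    and dual_basis: "\<forall>s\<in>S. \<alpha>d s \<in> Vd \<and> (\<forall>t\<in>S. \<alpha>d s (\<alpha> t) = of_bool (s = t))"
    and \<gamma>_eq: "\<gamma> = gamma S m k a \<alpha>d"
    and A_eq: "A = cos_matrix m k a"
    and V1_eq: "V1 = module.span fun_scale (\<gamma> ` S)"
  shows
    "group_rep W fun_scale Vd \<rho>d \<and>
     (\<forall>s\<in>S. \<gamma> s \<noteq> 0 \<and> {f \<in> Vd. \<rho>d s f = - f} = module.span fun_scale {\<gamma> s}) \<and>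
     \<comment> \<open>(1)\<close>
     ((fam_independent fun_scale S \<gamma> \<longleftrightarrow> matrix_invertible_on S A) \<and>
      (matrix_invertible_on S A \<longleftrightarrow> semisimple_rep W scale UNIV \<rho>)) \<and>
     \<comment> \<open>(2)\<close>
     (semisimple_rep W scale UNIV \<rho> \<longrightarrow>
        fam_basis fun_scale Vd S \<gamma> \<and>
        ir_rep W S fun_scale Vd \<rho>d \<gamma> \<and>
        ir_rep_of_data W S m fun_scale Vd \<rho>d \<gamma> k (dual_character \<chi>)) \<and>
     \<comment> \<open>(3)\<close>
     subrep W fun_scale Vd \<rho>d V1 \<and>
     r_rep W S m fun_scale V1 \<rho>d \<gamma> \<and>
     (\<exists>\<rho>'. ir_rep_of_data W S m scale UNIV \<rho>' \<alpha> k (dual_character \<chi>)) \<and>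
     (\<forall>(scale' :: complex \<Rightarrow> 'w::ab_group_add \<Rightarrow> 'w) V' \<rho>' \<alpha>'.
        ir_rep_of_data W S m scale' V' \<rho>' \<alpha>' k (dual_character \<chi>) \<longrightarrow>
        quot_rep_iso W scale' V' \<rho>' (semisimple_kernel W S m scale' \<rho>' \<alpha>' k)
          fun_scale V1 \<rho>d) \<and>
     (\<forall>g\<in>carrier W. \<forall>X\<in>quot_space Vd V1. quot_act \<rho>d V1 g X = X)"
proof -
  have vs: "vector_space scale"
    using V by (simp add: ir_rep_of_datum_def ir_rep_def group_rep_def)
  have "full_ir_representation W S m scale \<rho> \<alpha> k a"
    using finite_m
    by (intro full_ir_representation.intro ir_representation.intro coxeter_group.intro
        ir_representation_axioms.intro coxeter vs finite_rank V) blast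
  then interpret R: full_ir_representation W S m scale \<rho> \<alpha> k a .
  \<comment> \<open>A functional is determined by its values at the roots, so the given dual basis
    is the family of coordinate functions.\<close>
  have \<alpha>d: "\<alpha>d t = R.coord t" if "t \<in> S" for t
    using dual_basis that unfolding Vd_eq
    by (intro R.dual_eqI R.coord_in_dual) (auto simp: R.coord_root)
  \<comment> \<open>The leading term supplies the diagonal entry 1 and the sum over
    \<open>S - {s}\<close> the other entries of row \<open>s\<close> of \<open>A\<close>.\<close>
  have \<gamma>: "\<gamma> s = R.form s" if s: "s \<in> S" for s
  proof
    fix v
    have "\<gamma> s v = R.coord s v - (\<Sum>t\<in>S - {s}. cos_coeff m k a s t * R.coord t v)"
      using s by (simp add: \<gamma>_eq gamma_def sum_fun_apply \<alpha>d)
    also have "\<dots> = R.coord s v + (\<Sum>t\<in>S - {s}. A s t * R.coord t v)"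
      unfolding diff_conv_add_uminus sum_negf[symmetric]
      by (intro arg_cong2[of _ _ _ _ "(+)"] sum.cong refl) (auto simp: A_eq cos_matrix_def)
    also have "\<dots> = R.form s v"
      using s finite_rank by (simp add: R.form_def A_eq sum.remove[of S s])
    finally show "\<gamma> s v = R.form s v" .
  qed
  have img: "\<gamma> ` S = R.form ` S" using \<gamma> by (rule image_cong[OF refl])
  have ind: "fam_independent fun_scale S \<gamma> \<longleftrightarrow> fam_independent fun_scale S R.form"
    using \<gamma> by (rule fam_independent_cong)
  have V1: "V1 = R.dual_span" by (simp only: V1_eq img)
  have inv: "fam_independent fun_scale S \<gamma> \<longleftrightarrow> matrix_invertible_on S A"
    by (simp only: ind A_eq R.form_independent_iff)
  have semisimple: "matrix_invertible_on S A \<longleftrightarrow> semisimple_rep W scale UNIV \<rho>"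
    unfolding A_eq R.radical_trivial_iff_invertible[symmetric]
    using R.semisimple_if_radical_trivial R.radical_trivial_if_semisimple by blast
  have \<chi>_dual: "character_of_datum S m k (\<lambda>r t. a t r) (dual_character \<chi>)"
    using \<chi> by (rule character_of_datum_dual)
  have datum: "ir_rep_of_datum W S m fun_scale Vd \<rho>d \<gamma> k (\<lambda>r t. a t r)"
    if "semisimple_rep W scale UNIV \<rho>"
  proof -
    have "fam_independent fun_scale S R.form" using that by (simp only: ind[symmetric] inv semisimple)
    then have "ir_rep_of_datum W S m fun_scale Vd \<rho>d R.form k (\<lambda>r t. a t r)"
      unfolding Vd_eq \<rho>d_eq by (rule R.dual_ir_rep_of_datum)
    moreover have "R.form s = \<gamma> s" if "s \<in> S" for s using \<gamma>[OF that] by simp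
    ultimately show ?thesis by (rule iffD1[OF ir_rep_of_datum_cong, rotated])
  qed
  show ?thesis
  proof (intro conjI ballI allI impI)
    show "group_rep W fun_scale Vd \<rho>d" unfolding Vd_eq \<rho>d_eq by (rule R.dual_rep)
    fix s assume s: "s \<in> S"
    show "\<gamma> s \<noteq> 0" unfolding \<gamma>[OF s] by (rule R.form_nonzero[OF s])
    show "{f \<in> Vd. \<rho>d s f = - f} = module.span fun_scale {\<gamma> s}"
      unfolding \<gamma>[OF s] Vd_eq \<rho>d_eq by (rule R.dual_eigenspace[OF s])
  next
    assume ss: "semisimple_rep W scale UNIV \<rho>"
    show "ir_rep W S fun_scale Vd \<rho>d \<gamma>" using datum[OF ss] by (simp add: ir_rep_of_datum_def)
    then show "fam_basis fun_scale Vd S \<gamma>" by (simp add: ir_rep_def)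
    show "ir_rep_of_data W S m fun_scale Vd \<rho>d \<gamma> k (dual_character \<chi>)"
      unfolding ir_rep_of_data_def using datum[OF ss] \<chi>_dual by blast
  next
    show "subrep W fun_scale Vd \<rho>d V1"
      unfolding V1 Vd_eq \<rho>d_eq by (rule R.dual_span_subrep)
    show "r_rep W S m fun_scale V1 \<rho>d \<gamma>"
      unfolding V1 \<rho>d_eq by (rule iffD2[OF r_rep_cong R.dual_span_r_rep]) (rule \<gamma>)
    \<comment> \<open>The witness \<open>act_t\<close> lives on the same space with the same basis
      and does not require \<open>A\<close> to be invertible.\<close>
    show "\<exists>\<rho>'. ir_rep_of_data W S m scale UNIV \<rho>' \<alpha> k (dual_character \<chi>)"
      unfolding ir_rep_of_data_def using R.ir_rep_of_datum_act_t \<chi>_dual by blast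
  next
    fix scale' :: "complex \<Rightarrow> 'w \<Rightarrow> 'w" and V' \<rho>' \<alpha>'
    assume "ir_rep_of_data W S m scale' V' \<rho>' \<alpha>' k (dual_character \<chi>)"
    then show "quot_rep_iso W scale' V' \<rho>' (semisimple_kernel W S m scale' \<rho>' \<alpha>' k) fun_scale V1 \<rho>d"
      unfolding V1 \<rho>d_eq by (rule R.quot_rep_iso_dual_span[OF \<chi>])
  next
    fix g X assume "g \<in> carrier W" "X \<in> quot_space Vd V1"
    then show "quot_act \<rho>d V1 g X = X"
      unfolding V1 \<rho>d_eq Vd_eq by (rule R.dual_quotient_trivial)
  qed (rule inv semisimple)+
qed

end
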